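(* For all integers $l,k\ge 0$ the additional flow $\partial_{t^*_{l,k}}$, defined on the dressing operator $S$ of the KP hierarchy by $\partial_{t^*_{l,k}}S=-(e^{lM}q^{kL})_-S$, is a symmetry of the KP hierarchy; that is, it commutes with all the KP flows: $[\partial_{t^*_{l,k}},\partial_{t_n}]S=0$ for all $n\ge 1$.
   Context: Work with (formal) pseudo-differential operators $\sum_i p_i\partial^i$ in $\partial=\partial/\partial x$, with product given by $\partial^n\circ f=\sum_{j\ge 0}\binom nj(\partial^jf)\partial^{n-j}$, $n\in\mathbb Z$. For such an operator $A$, $A_+$ denotes its part with powers $\partial^i$, $i\ge0$, and $A_-=A-A_+$. KP hierarchy: the Lax operator is $L=\partial+u_{-1}\partial^{-1}+u_{-2}\partial^{-2}+\cdots$, with coefficients depending on $x$ and $t=(t_1,t_2,\dots)$, where $t_1$ is identified with $x$. It satisfies $\partial L/\partial t_n=[(L^n)_+,L]$, $n\ge1$. It is written $L=S\partial S^{-1}$ with dressing operator $S=1+\sum_{k\ge1}\omega_k\partial^{-k}$ satisfying the Sato equations $\partial S/\partial t_n=-(L^n)_-S$. Orlov–Shulman operator: $M=S\Gamma S^{-1}$ with $\Gamma=\sum_{i\ge1}it_i\partial^{i-1}$; one has $[L,M]=1$. Let $q$ be a parameter. The operator $e^{mM}q^{nL}$ denotes the formal series $\sum_{p,s\ge0}\frac{m^p(n\log q)^s}{p!\,s!}M^pL^s$. The additional flows $\partial_{t^*_{m,n}}$, $m,n\ge0$, are derivations on the coefficients of $S$ defined by $\partial_{t^*_{m,n}}S=-(e^{mM}q^{nL})_-S$;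 equivalently $\partial_{t^*_{m,n}}L=-[(e^{mM}q^{nL})_-,L]$ and $\partial_{t^*_{m,n}}M=-[(e^{mM}q^{nL})_-,M]$. *)

theory Defs
  imports Complex_Main "HOL-Library.Poly_Mapping"
begin

text \<open>
  The coefficient algebra of the pseudo-differential operators is the ring of formal power series
  in countably many commuting variables over an arbitrary commutative \<open>\<real>\<close>-algebra \<open>'b\<close>.
  A monomial is a finitely supported exponent vector \<open>nat \<Rightarrow>\<^sub>0 nat\<close>.  For \<open>i \<ge> 1\<close> the variable with
  index \<open>i\<close> is the time \<open>t\<^sub>i\<close> (and \<open>t\<^sub>1 = x\<close>); the variable with index 0 is the formal parameter
  \<open>log q\<close>.  The ring \<open>'b\<close> leaves room for further quantities, for instance the differential
  indeterminates generated by a generic dressing operator.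
\<close>

typedef 'b tseries = "UNIV :: ((nat \<Rightarrow>\<^sub>0 nat) \<Rightarrow> 'b) set"
  morphisms tcoeff TSeries
  by simp

lemma tcoeff_TSeries [simp]: "tcoeff (TSeries f) = f"
  by (simp add: TSeries_inverse)

lemma tseries_eqI: "(\<And>m. tcoeff f m = tcoeff g m) \<Longrightarrow> f = g"
  by (metis ext tcoeff_inject)

definition splits :: "(nat \<Rightarrow>\<^sub>0 nat) \<Rightarrow> ((nat \<Rightarrow>\<^sub>0 nat) \<times> (nat \<Rightarrow>\<^sub>0 nat)) set" where
  "splits m = {(a, b). a + b = m}"

lemma finite_splits [simp]: "finite (splits m)"
proof -
  define F where "F = {f :: nat \<Rightarrow> nat. \<forall>x. (x \<in> Poly_Mapping.keys m \<longrightarrow> f x \<in> {..Max (Poly_Mapping.lookup m ` Poly_Mapping.keys m)}) \<and>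
    (x \<notin> Poly_Mapping.keys m \<longrightarrow> f x = 0)}"
  have "finite F"
    unfolding F_def by (rule finite_set_of_finite_funs) auto
  have sub: "Poly_Mapping.lookup a \<in> F" if "a + b = m" for a b
  proof -
    have le: "Poly_Mapping.lookup a x \<le> Poly_Mapping.lookup m x" for x
      using that by (auto simp: lookup_add)
    have "Poly_Mapping.lookup a x \<le> Max (Poly_Mapping.lookup m ` Poly_Mapping.keys m)" if "x \<in> Poly_Mapping.keys m" for x
      by (rule order_trans[OF le]) (use that in simp)
    moreover have "Poly_Mapping.lookup a x = 0" if "x \<notin> Poly_Mapping.keys m" for x
      using le[of x] that by (simp add: in_keys_iff)
    ultimately show ?thesis
      by (auto simp: F_def)
  qed
  have "splits m \<subseteq> (Abs_poly_mapping ` F) \<times> (Abs_poly_mapping ` F)"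
  proof clarify
    fix a b assume "(a, b) \<in> splits m"
    then have "a + b = m" "b + a = m"
      by (auto simp: splits_def add.commute)
    then have "Poly_Mapping.lookup a \<in> F" "Poly_Mapping.lookup b \<in> F"
      using sub by blast+
    then show "a \<in> Abs_poly_mapping ` F \<and> b \<in> Abs_poly_mapping ` F"
      by (metis imageI lookup_inverse)
  qed
  then show ?thesis
    by (rule finite_subset) (use \<open>finite F\<close> in simp)
qed

lemma splits_0_left: "sum (\<lambda>(a, b). if a = 0 then h b else 0) (splits m) = (h m :: 'b::comm_monoid_add)"
proof -
  have "sum (\<lambda>(a, b). if a = 0 then h b else 0) (splits m) =
        sum (\<lambda>(a, b). if a = 0 then h b else 0) {(0 :: nat \<Rightarrow>\<^sub>0 nat, m)}"
    by (rule sum.mono_neutral_right[OF finite_splits]) (auto simp: splits_def split: if_splits)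
  then show ?thesis by simp
qed

lemma splits_assoc:
  "(\<Sum>(u, c)\<in>splits m. \<Sum>(a, b)\<in>splits u. h a b c) =
   (\<Sum>(a, v)\<in>splits m. \<Sum>(b, c)\<in>splits v. (h a b c :: 'b::comm_monoid_add))"
proof -
  have "(\<Sum>(u, c)\<in>splits m. \<Sum>(a, b)\<in>splits u. h a b c) =
    (\<Sum>((u, c), (a, b))\<in>(SIGMA p:splits m. splits (fst p)). h a b c)"
    by (subst sum.Sigma[symmetric]) (auto simp: case_prod_beta)
  also have "\<dots> = (\<Sum>((a, v), (b, c))\<in>(SIGMA p:splits m. splits (snd p)). h a b c)"
    by (rule sum.reindex_bij_witness[where
          i = "\<lambda>((a, v), (b, c)). ((a + b, c), (a, b))" and
          j = "\<lambda>((u, c), (a, b)). ((a, b + c), (b, c))"])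
       (auto simp: splits_def add.assoc)
  also have "\<dots> = (\<Sum>(a, v)\<in>splits m. \<Sum>(b, c)\<in>splits v. h a b c)"
    by (subst sum.Sigma[symmetric]) (auto simp: case_prod_beta)
  finally show ?thesis .
qed

instantiation tseries :: (comm_ring_1) comm_ring_1
begin

definition "0 = TSeries (\<lambda>_. 0)"
definition "1 = TSeries (\<lambda>m. if m = 0 then 1 else 0)"
definition "f + g = TSeries (\<lambda>m. tcoeff f m + tcoeff g m)"
definition "- f = TSeries (\<lambda>m. - tcoeff f m)"
definition "f - g = TSeries (\<lambda>m. tcoeff f m - tcoeff g m)"
definition "f * g = TSeries (\<lambda>m. \<Sum>(a, b)\<in>splits m. tcoeff f a * tcoeff g b)"

instance
proof
  fix f g h :: "'a tseries"
  show "f * g * h = f * (g * h)"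
  proof (rule tseries_eqI)
    fix m
    have "tcoeff (f * g * h) m =
      (\<Sum>(u, c)\<in>splits m. \<Sum>(a, b)\<in>splits u. tcoeff f a * tcoeff g b * tcoeff h c)"
      by (simp add: times_tseries_def case_prod_beta sum_distrib_right)
    also have "\<dots> = (\<Sum>(a, v)\<in>splits m. \<Sum>(b, c)\<in>splits v. tcoeff f a * tcoeff g b * tcoeff h c)"
      by (rule splits_assoc)
    also have "\<dots> = tcoeff (f * (g * h)) m"
      by (simp add: times_tseries_def case_prod_beta sum_distrib_left mult.assoc)
    finally show "tcoeff (f * g * h) m = tcoeff (f * (g * h)) m" .
  qed
  show "f * g = g * f"
  proof (rule tseries_eqI)
    fix m
    have "(\<Sum>(a, b)\<in>splits m. tcoeff f a * tcoeff g b) = (\<Sum>(a, b)\<in>splits m. tcoeff g a * tcoeff f b)"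
      by (rule sum.reindex_bij_witness[where i = prod.swap and j = prod.swap])
         (auto simp: splits_def add.commute mult.commute)
    then show "tcoeff (f * g) m = tcoeff (g * f) m"
      by (simp add: times_tseries_def)
  qed
  show "1 * f = f"
  proof (rule tseries_eqI)
    fix m
    have "tcoeff (1 * f) m = (\<Sum>(a, b)\<in>splits m. if a = 0 then tcoeff f b else 0)"
      by (auto simp: times_tseries_def one_tseries_def intro!: sum.cong)
    then show "tcoeff (1 * f) m = tcoeff f m"
      by (simp add: splits_0_left)
  qed
  show "(f + g) * h = f * h + g * h"
    by (rule tseries_eqI)
       (simp add: times_tseries_def plus_tseries_def case_prod_beta distrib_right sum.distrib)
  have "tcoeff (0 :: 'a tseries) 0 \<noteq> tcoeff 1 0"
    by (simp add: zero_tseries_def one_tseries_def)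
  then show "(0 :: 'a tseries) \<noteq> 1" by metis
qed (auto intro!: tseries_eqI
      simp: zero_tseries_def plus_tseries_def uminus_tseries_def minus_tseries_def algebra_simps)

end

instantiation tseries :: ("{comm_ring_1,real_algebra_1}") real_algebra_1
begin

definition "r *\<^sub>R f = TSeries (\<lambda>m. r *\<^sub>R tcoeff f m)"

instance
  by standard
     (auto intro!: tseries_eqI
       simp: scaleR_tseries_def plus_tseries_def times_tseries_def scaleR_add_left scaleR_add_right
         scaleR_sum_right case_prod_beta)

end

definition Var :: "nat \<Rightarrow> 'b::comm_ring_1 tseries" where
  "Var i = TSeries (\<lambda>m. if m = Poly_Mapping.single i 1 then 1 else 0)"

abbreviation log_q :: "'b::comm_ring_1 tseries" where
  "log_q \<equiv> Var 0"

text \<open>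
  Infinite sums of series are taken monomial by monomial.  They are meaningful when every
  monomial receives only finitely many nonzero contributions (\<open>Sum_any\<close> is 0 otherwise); this is
  the case for all the sums used below.
\<close>

definition formal_sum :: "('i \<Rightarrow> 'b::comm_ring_1 tseries) \<Rightarrow> 'b tseries" where
  "formal_sum f = TSeries (\<lambda>m. Sum_any (\<lambda>i. tcoeff (f i) m))"

text \<open>
  Derivations of the coefficient algebra are required to be continuous for the topology of
  coefficientwise (discrete) convergence, so that they may be applied termwise to formal sums.
\<close>

definition continuous_derivation :: "('b::comm_ring_1 tseries \<Rightarrow> 'b tseries) \<Rightarrow> bool" where
  "continuous_derivation d \<longleftrightarrow>
     (\<forall>f g. d (f + g) = d f + d g) \<and>
     (\<forall>f g. d (f * g) = d f * g + f * d g) \<and>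
     (\<forall>m. \<exists>K. finite K \<and> (\<forall>f. (\<forall>k\<in>K. tcoeff f k = 0) \<longrightarrow> tcoeff (d f) m = 0))"

text \<open>
  A formal pseudo-differential operator \<open>A\<close> stands for the sum of \<open>A i\<close> times \<open>\<partial>\<^sup>i\<close> over all
  integers \<open>i\<close>.  The order is not required to be bounded above, because \<open>\<Gamma>\<close> and \<open>M\<close> involve
  infinitely many positive powers of \<open>\<partial>\<close>.
\<close>

type_synonym 'b psdo = "int \<Rightarrow> 'b tseries"

definition psdo_monom :: "int \<Rightarrow> 'b::comm_ring_1 psdo" where
  "psdo_monom k = (\<lambda>n. if n = k then 1 else 0)"

definition psdo_plus_part :: "'b::comm_ring_1 psdo \<Rightarrow> 'b psdo" where
  "psdo_plus_part A = (\<lambda>n. if n \<ge> 0 then A n else 0)"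

definition psdo_minus_part :: "'b::comm_ring_1 psdo \<Rightarrow> 'b psdo" where
  "psdo_minus_part A = (\<lambda>n. A n - psdo_plus_part A n)"

text \<open>
  The product extends \<open>\<partial>\<^sup>i \<circ> f = (\<Sum>r\<ge>0. (i choose r) (\<partial>\<^sup>r f) \<partial>\<^bsup>i-r\<^esup>)\<close>: the coefficient
  of \<open>\<partial>\<^sup>n\<close> collects the terms \<open>A\<^sub>i \<partial>\<^sup>i \<circ> B\<^sub>j \<partial>\<^sup>j\<close> with \<open>i + j - r = n\<close>.  The first argument is the
  derivation \<open>\<partial>\<close> of the coefficients.
\<close>

definition psdo_mult ::
  "('b tseries \<Rightarrow> 'b tseries) \<Rightarrow> 'b::{comm_ring_1,real_algebra_1} psdo \<Rightarrow> 'b psdo \<Rightarrow> 'b psdo" where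
  "psdo_mult d A B = (\<lambda>n. formal_sum (\<lambda>(i :: int, r :: nat).
     (real_of_int i gchoose r) *\<^sub>R (A i * (d ^^ r) (B (n - i + int r)))))"

primrec psdo_pow ::
  "('b tseries \<Rightarrow> 'b tseries) \<Rightarrow> 'b::{comm_ring_1,real_algebra_1} psdo \<Rightarrow> nat \<Rightarrow> 'b psdo" where
  "psdo_pow d A 0 = psdo_monom 0"
| "psdo_pow d A (Suc n) = psdo_mult d A (psdo_pow d A n)"

definition dressing_op :: "'b::comm_ring_1 psdo \<Rightarrow> bool" where
  "dressing_op S \<longleftrightarrow> S 0 = 1 \<and> (\<forall>n>0. S n = 0)"

definition psdo_inv ::
  "('b tseries \<Rightarrow> 'b tseries) \<Rightarrow> 'b::{comm_ring_1,real_algebra_1} psdo \<Rightarrow> 'b psdo" where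
  "psdo_inv d S = (THE T. (\<forall>n>0. T n = 0) \<and>
     psdo_mult d S T = psdo_monom 0 \<and> psdo_mult d T S = psdo_monom 0)"

definition Lax_op ::
  "('b tseries \<Rightarrow> 'b tseries) \<Rightarrow> 'b::{comm_ring_1,real_algebra_1} psdo \<Rightarrow> 'b psdo" where
  "Lax_op d S = psdo_mult d (psdo_mult d S (psdo_monom 1)) (psdo_inv d S)"

definition Gamma_op :: "'b::comm_ring_1 psdo" where
  "Gamma_op = (\<lambda>n. if n \<ge> 0 then of_int (n + 1) * Var (nat (n + 1)) else 0)"

definition Orlov_Shulman_op ::
  "('b tseries \<Rightarrow> 'b tseries) \<Rightarrow> 'b::{comm_ring_1,real_algebra_1} psdo \<Rightarrow> 'b psdo" where
  "Orlov_Shulman_op d S = psdo_mult d (psdo_mult d S Gamma_op) (psdo_inv d S)"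

text \<open>The operator \<open>e\<^bsup>lM\<^esup> q\<^bsup>kL\<^esup>\<close>, as a formal series in \<open>log q\<close>.\<close>

definition exp_op ::
  "('b tseries \<Rightarrow> 'b tseries) \<Rightarrow> 'b::{comm_ring_1,real_algebra_1} psdo \<Rightarrow> nat \<Rightarrow> nat \<Rightarrow> 'b psdo" where
  "exp_op d S l k = (\<lambda>n. formal_sum (\<lambda>(p :: nat, s :: nat).
     (1 / (fact p * fact s)) *\<^sub>R (of_nat l ^ p * (of_nat k * log_q) ^ s *
       psdo_mult d (psdo_pow d (Orlov_Shulman_op d S) p) (psdo_pow d (Lax_op d S) s) n)))"

text \<open>
  \<open>dt n\<close> is \<open>\<partial>/\<partial>t\<^sub>n\<close> for \<open>n \<ge> 1\<close>, and \<open>\<partial> = dt 1\<close> because \<open>t\<^sub>1 = x\<close>; the value at \<open>n = 0\<close> is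
  irrelevant.  The elements of \<open>'b\<close> need not be constants.  The case \<open>i = 0\<close> of the second
  condition says that \<open>log q\<close> does not depend on the times.
\<close>

definition KP_time_derivations ::
  "(nat \<Rightarrow> 'b::comm_ring_1 tseries \<Rightarrow> 'b tseries) \<Rightarrow> bool" where
  "KP_time_derivations dt \<longleftrightarrow> (\<forall>n\<ge>1.
     continuous_derivation (dt n) \<and>
     (\<forall>i. dt n (Var i) = (if i = n then 1 else 0)) \<and>
     (\<forall>m\<ge>1. \<forall>f. dt m (dt n f) = dt n (dt m f)))"

definition Sato_equations ::
  "(nat \<Rightarrow> 'b tseries \<Rightarrow> 'b tseries) \<Rightarrow> 'b::{comm_ring_1,real_algebra_1} psdo \<Rightarrow> bool" where
  "Sato_equations dt S \<longleftrightarrow> (\<forall>n\<ge>1. \<forall>j. dt n (S j) =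
     - psdo_mult (dt 1) (psdo_minus_part (psdo_pow (dt 1) (Lax_op (dt 1) S) n)) S j)"

text \<open>
  \<open>D\<close> is the additional flow with indices \<open>l, k\<close>: a derivation of the coefficients, determined on
  those of \<open>S\<close> by the defining equation.  As usual for flows, it does not act on the independent
  variables \<open>t\<^sub>i\<close> nor on the parameter \<open>log q\<close>, and it is extended to the \<open>x\<close>-derivatives of the
  coefficients by commuting with \<open>\<partial>\<close>.
\<close>

definition additional_flow ::
  "(nat \<Rightarrow> 'b tseries \<Rightarrow> 'b tseries) \<Rightarrow> 'b::{comm_ring_1,real_algebra_1} psdo \<Rightarrow> nat \<Rightarrow> nat \<Rightarrow>
    ('b tseries \<Rightarrow> 'b tseries) \<Rightarrow> bool" where
  "additional_flow dt S l k D \<longleftrightarrow>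
     continuous_derivation D \<and>
     (\<forall>i. D (Var i) = 0) \<and>
     (\<forall>f. D (dt 1 f) = dt 1 (D f)) \<and>
     (\<forall>j. D (S j) = - psdo_mult (dt 1) (psdo_minus_part (exp_op (dt 1) S l k)) S j)"

end

theory Submission
  imports Defs "HOL-Library.Function_Algebras" "HOL-Computational_Algebra.Formal_Power_Series"
begin

text \<open>
  With \<open>X = L\<^sup>n = S \<partial>\<^sup>n S\<^sup>-\<^sup>1\<close> and \<open>E = e\<^bsup>lM\<^esup> q\<^bsup>kL\<^esup>\<close>, the Sato equations say \<open>\<partial>\<^sub>n S = - X\<^sub>- S\<close>, and
  coefficientwise \<open>\<partial>\<^sub>n P = [\<partial>\<^sup>n, P]\<close> for both \<open>P = \<partial>\<close> and \<open>P = \<Gamma>\<close>.  Conjugation by \<open>S\<close> turns this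
  into \<open>\<partial>\<^sub>n L = [X\<^sub>+, L]\<close> and \<open>\<partial>\<^sub>n M = [X\<^sub>+, M]\<close>, hence \<open>\<partial>\<^sub>n E = [X\<^sub>+, E]\<close>, while the additional flow
  acts by \<open>D X = - [E\<^sub>-, X]\<close>.  Therefore \<open>[D, \<partial>\<^sub>n] S\<close> is the product of
  \<open>[E\<^sub>-, X]\<^sub>- + [X\<^sub>+, E]\<^sub>- - [E\<^sub>-, X\<^sub>-] = 0\<close> with \<open>S\<close>.

  The operators have infinitely many positive and negative powers of \<open>\<partial>\<close>, so convergence needs an
  argument.  Give \<open>t\<^sub>i\<close> the weight \<open>2i - 1\<close> and \<open>log q\<close> the weight 3.  Then \<open>\<partial>\<close> lowers weights by at
  most 1, and the operators whose coefficient of \<open>\<partial>\<^sup>i\<close> has weight at least \<open>2i + c\<close> for some constant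
  \<open>c\<close> multiply convergently: in \<open>A\<^sub>i \<partial>\<^sup>r(B\<^sub>j) \<partial>\<^bsup>i+j-r\<^esup>\<close> each derivative costs 1 in weight but lowers
  the order by 1, which is worth 2.  The constants are \<open>c = 0\<close> for \<open>S\<close> and its inverse, 1 for \<open>\<Gamma>\<close> and
  \<open>M\<close>, and \<open>-2\<close> for \<open>L\<close>, so the term \<open>(log q)\<^sup>s M\<^sup>p L\<^sup>s\<close> of \<open>E\<close> has \<open>c = 3s + p - 2s = p + s\<close>.
\<close>

subsection \<open>The weight filtration\<close>

text \<open>The value \<open>2 * i - 1\<close> makes the coefficient i t_i of \<partial>^(i-1) in
  \<open>Gamma_op\<close> meet the bound 2(i-1) + 1 exactly. The value 3 for \<open>log_q\<close>
  beats by one the loss of 2 that each factor \<open>L\<close> causes.\<close>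

definition var_weight :: "nat \<Rightarrow> nat" where
  "var_weight i = (if i = 0 then 3 else 2 * i - 1)"

definition weight :: "(nat \<Rightarrow>\<^sub>0 nat) \<Rightarrow> nat" where
  "weight m = (\<Sum>i\<in>Poly_Mapping.keys m. Poly_Mapping.lookup m i * var_weight i)"

lemma weight_superset:
  assumes "finite K" "Poly_Mapping.keys m \<subseteq> K"
  shows "weight m = (\<Sum>i\<in>K. Poly_Mapping.lookup m i * var_weight i)"
  unfolding weight_def
  by (rule sum.mono_neutral_left) (use assms in \<open>auto simp: in_keys_iff\<close>)

lemma weight_add: "weight (a + b) = weight a + weight b"
proof -
  let ?K = "Poly_Mapping.keys a \<union> Poly_Mapping.keys b"
  have "Poly_Mapping.keys (a + b) \<subseteq> ?K"
    by (rule keys_add)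
  then show ?thesis
    by (simp add: weight_superset[of ?K] lookup_add distrib_right sum.distrib)
qed

lemma weight_0 [simp]: "weight 0 = 0"
  by (simp add: weight_def)

lemma weight_single [simp]: "weight (Poly_Mapping.single i 1) = var_weight i"
  by (simp add: weight_def)

lemma var_weight_pos: "var_weight i > 0"
  by (simp add: var_weight_def)

text \<open>Elements of \<open>'b\<close> have weight 0, so a nonpositive index imposes no
  condition. Integer indices allow a loss of weight to be subtracted without truncation.\<close>

definition filt :: "int \<Rightarrow> 'b::comm_ring_1 tseries set" where
  "filt w = {f. \<forall>m. tcoeff f m \<noteq> 0 \<longrightarrow> w \<le> int (weight m)}"

lemma filtD: "f \<in> filt w \<Longrightarrow> int (weight m) < w \<Longrightarrow> tcoeff f m = 0"
  by (force simp: filt_def)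

lemma filt_nonpos: "w \<le> 0 \<Longrightarrow> f \<in> filt w"
  by (simp add: filt_def)

lemma filt_mono: "f \<in> filt w \<Longrightarrow> w' \<le> w \<Longrightarrow> f \<in> filt w'"
  by (force simp: filt_def)

lemma filt_0 [simp]: "0 \<in> filt w"
  by (simp add: filt_def zero_tseries_def)

lemma filt_add: "f \<in> filt w \<Longrightarrow> g \<in> filt w \<Longrightarrow> f + g \<in> filt w"
  by (force simp: filt_def plus_tseries_def)

lemma filt_uminus: "f \<in> filt w \<Longrightarrow> - f \<in> filt w"
  by (simp add: filt_def uminus_tseries_def)

lemma filt_diff: "f \<in> filt w \<Longrightarrow> g \<in> filt w \<Longrightarrow> f - g \<in> filt w"
  using filt_add[of f w "- g"] filt_uminus[of g w] by simp

lemma filt_sum: "(\<And>i. i \<in> I \<Longrightarrow> f i \<in> filt w) \<Longrightarrow> sum f I \<in> filt w"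
  by (induction I rule: infinite_finite_induct) (auto intro: filt_add)

lemma filt_scaleR: "f \<in> filt w \<Longrightarrow> r *\<^sub>R f \<in> filt w"
  by (auto simp: filt_def scaleR_tseries_def)

lemma filt_mult:
  assumes "f \<in> filt v" "g \<in> filt w"
  shows "f * g \<in> filt (v + w)"
  unfolding filt_def
proof (intro CollectI allI impI)
  fix m assume "tcoeff (f * g) m \<noteq> 0"
  then have "(\<Sum>(a, b)\<in>splits m. tcoeff f a * tcoeff g b) \<noteq> 0"
    by (simp add: times_tseries_def)
  then obtain p where p: "p \<in> splits m" "(case p of (a, b) \<Rightarrow> tcoeff f a * tcoeff g b) \<noteq> 0"
    by (rule sum.not_neutral_contains_not_neutral)
  obtain a b where "p = (a, b)" by force
  with p have "a + b = m" "tcoeff f a \<noteq> 0" "tcoeff g b \<noteq> 0"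
    by (auto simp: splits_def)
  then show "v + w \<le> int (weight m)"
    using assms by (force simp: filt_def weight_add)
qed

lemma filt_mult_left: "g \<in> filt w \<Longrightarrow> f * g \<in> filt w"
  using filt_mult[of f 0 g w] by (simp add: filt_nonpos)

lemma filt_mult_right: "f \<in> filt w \<Longrightarrow> f * g \<in> filt w"
  using filt_mult_left[of f w g] by (simp add: mult.commute)

lemma filt_power: "f \<in> filt w \<Longrightarrow> f ^ n \<in> filt (int n * w)"
proof (induction n)
  case (Suc n)
  then show ?case
    using filt_mult[of f w "f ^ n" "int n * w"] by (simp add: algebra_simps)
qed (simp add: filt_nonpos)

lemma filt_formal_sum: "(\<And>i. f i \<in> filt w) \<Longrightarrow> formal_sum f \<in> filt w"
  unfolding filt_def formal_sum_def
  by (auto elim!: Sum_any.not_neutral_obtains_not_neutral)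

lemma filt_Var: "Var i \<in> filt (int (var_weight i))"
  by (auto simp: filt_def Var_def simp del: One_nat_def)

text \<open>The filtration is separated: every monomial has a finite weight.\<close>

lemma filt_eqI:
  assumes "\<And>w. f - g \<in> filt w"
  shows "f = g"
proof (rule tseries_eqI)
  fix m
  have "tcoeff (f - g) m = 0"
    by (rule filtD[OF assms[of "int (weight m) + 1"]]) simp
  then show "tcoeff f m = tcoeff g m"
    by (simp add: minus_tseries_def)
qed

subsection \<open>Formal sums\<close>

text \<open>Convergence is measured by weight instead of monomial by monomial, so it passes through
  every map that lowers weights by a bounded amount.\<close>

definition fsummable :: "('i \<Rightarrow> 'b::comm_ring_1 tseries) \<Rightarrow> bool" where
  "fsummable f \<longleftrightarrow> (\<forall>w. finite {i. f i \<notin> filt w})"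

lemma fsummableD: "fsummable f \<Longrightarrow> finite {i. f i \<notin> filt w}"
  by (simp add: fsummable_def)

text \<open>A monomial of weight below \<open>w\<close> receives contributions from \<open>F\<close>
  only.\<close>

lemma formal_sum_approx:
  assumes "finite F" "\<And>i. i \<notin> F \<Longrightarrow> f i \<in> filt w"
  shows "formal_sum f - sum f F \<in> filt w"
proof -
  have tsum: "tcoeff (sum f F) m = (\<Sum>i\<in>F. tcoeff (f i) m)" for m
    using assms(1) by induction (auto simp: zero_tseries_def plus_tseries_def)
  have "tcoeff (formal_sum f - sum f F) m = 0" if "int (weight m) < w" for m
  proof -
    have "Sum_any (\<lambda>i. tcoeff (f i) m) = (\<Sum>i\<in>F. tcoeff (f i) m)"
      by (rule Sum_any.expand_superset) (use assms filtD that in blast)+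
    then show ?thesis
      by (simp add: minus_tseries_def formal_sum_def tsum)
  qed
  then show ?thesis
    unfolding filt_def by force
qed

lemma formal_sum_eqI:
  assumes "\<And>w. \<exists>F. finite F \<and> (\<forall>i. i \<notin> F \<longrightarrow> f i \<in> filt w) \<and> x - sum f F \<in> filt w"
  shows "formal_sum f = x"
proof (rule filt_eqI)
  fix w
  obtain F where "finite F" "\<And>i. i \<notin> F \<Longrightarrow> f i \<in> filt w" "x - sum f F \<in> filt w"
    using assms by blast
  then show "formal_sum f - x \<in> filt w"
    using filt_diff[OF formal_sum_approx[of F f w], of "x - sum f F"] by simp
qed

lemma fsummable_finite: "finite F \<Longrightarrow> (\<And>i. i \<notin> F \<Longrightarrow> f i = 0) \<Longrightarrow> fsummable f"
  unfolding fsummable_def by (metis (mono_tags, lifting) filt_0 finite_subset mem_Collect_eq subsetI)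

lemma formal_sum_finite:
  assumes "finite F" "\<And>i. i \<notin> F \<Longrightarrow> f i = 0"
  shows "formal_sum f = sum f F"
  by (rule formal_sum_eqI) (use assms in \<open>auto intro!: exI[of _ F]\<close>)

lemma formal_sum_single:
  assumes "\<And>i. i \<noteq> a \<Longrightarrow> f i = 0"
  shows "formal_sum f = f a"
  using formal_sum_finite[of "{a}" f] assms by simp

lemma formal_sum_0 [simp]: "formal_sum (\<lambda>i. 0) = 0"
  using formal_sum_finite[of "{}" "\<lambda>i. 0"] by simp

lemma fsummable_additive:
  assumes "\<And>w f. f \<in> filt w \<Longrightarrow> \<phi> f \<in> filt (w - e)" and "fsummable f"
  shows "fsummable (\<lambda>i. \<phi> (f i))"
  unfolding fsummable_def
proof
  fix w
  have "{i. \<phi> (f i) \<notin> filt w} \<subseteq> {i. f i \<notin> filt (w + e)}"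
    using assms(1)[of _ "w + e"] by auto
  then show "finite {i. \<phi> (f i) \<notin> filt w}"
    using fsummableD[OF assms(2)] finite_subset by blast
qed

text \<open>A bounded loss of weight makes an additive map continuous: modulo \<open>filt w\<close>,
  its value on the sum depends only on the finitely many terms outside
  \<open>filt (w + e)\<close>.\<close>

lemma formal_sum_additive:
  assumes add: "\<And>f g. \<phi> (f + g) = \<phi> f + \<phi> g"
    and filt: "\<And>w f. f \<in> filt w \<Longrightarrow> \<phi> f \<in> filt (w - e)"
    and summ: "fsummable f"
  shows "\<phi> (formal_sum f) = formal_sum (\<lambda>i. \<phi> (f i))"
proof (rule sym, rule formal_sum_eqI)
  fix w
  have zero: "\<phi> 0 = 0"
    using add[of 0 0] by simp
  have sum: "\<phi> (sum g F) = (\<Sum>i\<in>F. \<phi> (g i))" if "finite F" for g and F :: "'c set"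
    using that by induction (auto simp: zero add)
  define F where "F = {i. f i \<notin> filt (w + e)}"
  have fin: "finite F"
    unfolding F_def by (rule fsummableD[OF summ])
  have out: "f i \<in> filt (w + e)" if "i \<notin> F" for i
    using that by (simp add: F_def)
  have "\<phi> (formal_sum f) - (\<Sum>i\<in>F. \<phi> (f i)) = \<phi> (formal_sum f - sum f F)"
    using add[of "formal_sum f - sum f F" "sum f F"] sum[OF fin] by simp
  also have "\<dots> \<in> filt w"
    using filt[OF formal_sum_approx[OF fin out]] by simp
  finally have "\<phi> (formal_sum f) - (\<Sum>i\<in>F. \<phi> (f i)) \<in> filt w" .
  moreover have "\<phi> (f i) \<in> filt w" if "i \<notin> F" for i
    using filt[OF out[OF that]] by simp
  ultimately show "\<exists>F. finite F \<and> (\<forall>i. i \<notin> F \<longrightarrow> \<phi> (f i) \<in> filt w) \<and>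
      \<phi> (formal_sum f) - (\<Sum>i\<in>F. \<phi> (f i)) \<in> filt w"
    using fin by blast
qed

lemma formal_sum_mult_left: "fsummable f \<Longrightarrow> c * formal_sum f = formal_sum (\<lambda>i. c * f i)"
  by (rule formal_sum_additive[where e = 0]) (auto simp: distrib_left intro: filt_mult_left)

lemma formal_sum_mult_right: "fsummable f \<Longrightarrow> formal_sum f * c = formal_sum (\<lambda>i. f i * c)"
  using formal_sum_mult_left[of f c] by (simp add: mult.commute)

lemma formal_sum_scaleR: "fsummable f \<Longrightarrow> r *\<^sub>R formal_sum f = formal_sum (\<lambda>i. r *\<^sub>R f i)"
  by (rule formal_sum_additive[where e = 0]) (auto simp: scaleR_add_right intro: filt_scaleR)

lemma formal_sum_uminus: "fsummable f \<Longrightarrow> - formal_sum f = formal_sum (\<lambda>i. - f i)"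
  by (rule formal_sum_additive[where e = 0]) (auto intro: filt_uminus)

lemma formal_sum_add:
  assumes "fsummable f" "fsummable g"
  shows "formal_sum (\<lambda>i. f i + g i) = formal_sum f + formal_sum g"
proof (rule formal_sum_eqI)
  fix w
  define F where "F = {i. f i \<notin> filt w} \<union> {i. g i \<notin> filt w}"
  have F: "finite F" "\<And>i. i \<notin> F \<Longrightarrow> f i \<in> filt w" "\<And>i. i \<notin> F \<Longrightarrow> g i \<in> filt w"
    using assms[THEN fsummableD] by (auto simp: F_def)
  have "formal_sum f + formal_sum g - (\<Sum>i\<in>F. f i + g i) =
      (formal_sum f - sum f F) + (formal_sum g - sum g F)"
    by (simp add: sum.distrib)
  also have "\<dots> \<in> filt w"
    using F by (intro filt_add formal_sum_approx)
  finally show "\<exists>F. finite F \<and> (\<forall>i. i \<notin> F \<longrightarrow> f i + g i \<in> filt w) \<and>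
      formal_sum f + formal_sum g - (\<Sum>i\<in>F. f i + g i) \<in> filt w"
    using F by (intro exI[of _ F]) (auto intro: filt_add)
qed

lemma formal_sum_diff:
  assumes "fsummable f" "fsummable g"
  shows "formal_sum (\<lambda>i. f i - g i) = formal_sum f - formal_sum g"
proof -
  have "fsummable (\<lambda>i. - g i)"
    by (rule fsummable_additive[where e = 0]) (use assms in \<open>auto intro: filt_uminus\<close>)
  then show ?thesis
    using formal_sum_add[of f "\<lambda>i. - g i"] assms formal_sum_uminus[of g] by simp
qed

lemma fsummable_outer:
  assumes "fsummable (\<lambda>(i, j). f i j)"
  shows "fsummable (\<lambda>i. formal_sum (f i))"
  unfolding fsummable_def
proof
  fix w
  have "{i. formal_sum (f i) \<notin> filt w} \<subseteq> fst ` {p. (case p of (i, j) \<Rightarrow> f i j) \<notin> filt w}"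
  proof
    fix i assume "i \<in> {i. formal_sum (f i) \<notin> filt w}"
    then obtain j where "f i j \<notin> filt w"
      using filt_formal_sum[of "f i" w] by auto
    then show "i \<in> fst ` {p. (case p of (i, j) \<Rightarrow> f i j) \<notin> filt w}"
      by (intro image_eqI[of _ _ "(i, j)"]) auto
  qed
  then show "finite {i. formal_sum (f i) \<notin> filt w}"
    using finite_subset[OF _ finite_imageI[OF fsummableD[OF assms]]] by blast
qed

text \<open>Fubini for formal sums. Modulo \<open>filt w\<close> only finitely many pairs matter,
  and they are enclosed in a finite rectangle \<open>F1 \<times> F2\<close>, where the double sum
  can be exchanged for a single one.\<close>

lemma formal_sum_pair:
  assumes "fsummable (\<lambda>(i, j). f i j)"
  shows "formal_sum (\<lambda>i. formal_sum (f i)) = formal_sum (\<lambda>(i, j). f i j)"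
proof (rule sym, rule formal_sum_eqI)
  fix w
  define F where "F = {p. (case p of (i, j) \<Rightarrow> f i j) \<notin> filt w}"
  have fin: "finite F"
    using assms by (simp add: F_def fsummableD)
  define F1 F2 where "F1 = fst ` F" and "F2 = snd ` F"
  have F12: "finite F1" "finite F2" "F \<subseteq> F1 \<times> F2"
    using fin by (force simp: F1_def F2_def)+
  have out: "f i j \<in> filt w" if "(i, j) \<notin> F1 \<times> F2" for i j
    using subsetD[OF F12(3), of "(i, j)"] that unfolding F_def by auto
  have "formal_sum (\<lambda>i. formal_sum (f i)) - (\<Sum>(i, j)\<in>F1 \<times> F2. f i j) =
      (formal_sum (\<lambda>i. formal_sum (f i)) - (\<Sum>i\<in>F1. formal_sum (f i))) +
      (\<Sum>i\<in>F1. formal_sum (f i) - (\<Sum>j\<in>F2. f i j))"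
    by (simp add: sum_subtractf sum.cartesian_product)
  also have "\<dots> \<in> filt w"
    using F12 out by (intro filt_add filt_sum formal_sum_approx filt_formal_sum) auto
  finally show "\<exists>F. finite F \<and> (\<forall>i. i \<notin> F \<longrightarrow> (case i of (i, j) \<Rightarrow> f i j) \<in> filt w) \<and>
      formal_sum (\<lambda>i. formal_sum (f i)) - (\<Sum>i\<in>F. case i of (i, j) \<Rightarrow> f i j) \<in> filt w"
    using F12 out by (intro exI[of _ "F1 \<times> F2"]) auto
qed

text \<open>The index maps need to be inverse to each other only on nonzero terms, because some of
  the index changes below involve truncated subtraction.\<close>

lemma formal_sum_witness:
  assumes "\<And>a. g a \<noteq> 0 \<Longrightarrow> i (j a) = a \<and> h (j a) = g a"
    and "\<And>b. h b \<noteq> 0 \<Longrightarrow> j (i b) = b \<and> g (i b) = h b"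
  shows "formal_sum g = formal_sum h"
proof (rule tseries_eqI)
  fix m
  have nz: "tcoeff f m \<noteq> 0 \<Longrightarrow> f \<noteq> 0" for f :: "'b tseries"
    by (auto simp: zero_tseries_def)
  let ?G = "{a. tcoeff (g a) m \<noteq> 0}" and ?H = "{b. tcoeff (h b) m \<noteq> 0}"
  have bij: "bij_betw j ?G ?H"
    by (rule bij_betw_byWitness[where f' = i]) (use assms nz in force)+
  \<comment> \<open>\<open>Sum_any\<close> has the default value 0 on an infinite support, so the
    two supports must be finite or infinite together.\<close>
  have "finite ?G = finite ?H"
    using bij by (rule bij_betw_finite)
  moreover have "(\<Sum>a\<in>?G. tcoeff (g a) m) = (\<Sum>b\<in>?H. tcoeff (h b) m)"
    by (rule sum.reindex_bij_witness[where i = i and j = j]) (use assms nz in force)+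
  ultimately show "tcoeff (formal_sum g) m = tcoeff (formal_sum h) m"
    by (simp add: formal_sum_def Sum_any.expand_set)
qed

lemma fsummable_witness:
  assumes "fsummable h" "\<And>a. g a \<noteq> 0 \<Longrightarrow> i (j a) = a \<and> h (j a) = g a"
  shows "fsummable g"
  unfolding fsummable_def
proof
  fix w
  have "{a. g a \<notin> filt w} \<subseteq> i ` {b. h b \<notin> filt w}"
  proof
    fix a assume a: "a \<in> {a. g a \<notin> filt w}"
    then have "g a \<noteq> 0" by auto
    then show "a \<in> i ` {b. h b \<notin> filt w}"
      using a assms(2)[of a] by (intro image_eqI[of _ _ "j a"]) auto
  qed
  then show "finite {a. g a \<notin> filt w}"
    using finite_subset[OF _ finite_imageI[OF fsummableD[OF assms(1)]]] by blast
qed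

lemma formal_sum_swap:
  assumes "fsummable (\<lambda>(i, j). f i j)"
  shows "formal_sum (\<lambda>i. formal_sum (f i)) = formal_sum (\<lambda>j. formal_sum (\<lambda>i. f i j))"
proof -
  have "fsummable (\<lambda>(j, i). f i j)"
    by (rule fsummable_witness[OF assms, where i = prod.swap and j = prod.swap]) auto
  moreover have "formal_sum (\<lambda>(i, j). f i j) = formal_sum (\<lambda>(j, i). f i j)"
    by (rule formal_sum_witness[where i = prod.swap and j = prod.swap]) auto
  ultimately show ?thesis
    using assms by (simp add: formal_sum_pair)
qed

lemma formal_sum_Suc:
  assumes "fsummable f"
  shows "formal_sum f = f 0 + formal_sum (\<lambda>k. f (Suc k))"
proof -
  define g where "g k = (if k = 0 then 0 else f k)" for k
  have "fsummable g"
    by (rule fsummable_witness[OF assms, where i = id and j = id]) (auto simp: g_def split: if_splits)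
  moreover have "fsummable (\<lambda>k. if k = 0 then f k else 0)"
    by (rule fsummable_finite[of "{0}"]) auto
  ultimately have "formal_sum (\<lambda>k. (if k = 0 then f k else 0) + g k) =
      formal_sum (\<lambda>k. if k = 0 then f k else 0) + formal_sum g"
    by (intro formal_sum_add)
  moreover have "formal_sum (\<lambda>k. if k = 0 then f k else 0) = f 0"
    by (subst formal_sum_single[of 0]) auto
  moreover have "formal_sum g = formal_sum (\<lambda>k. f (Suc k))"
    by (rule formal_sum_witness[where i = Suc and j = "\<lambda>k. k - 1"])
      (auto simp: g_def split: if_splits)
  moreover have "(\<lambda>k. (if k = 0 then f k else 0) + g k) = f"
    by (auto simp: g_def)
  ultimately show ?thesis by simp
qed

subsection \<open>Filtered derivations\<close>

text \<open>The parameter \<open>e\<close> is the weight lost: 1 for \<partial>,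
  \<open>2 * int n - 1\<close> for \<open>dt n\<close>, and 0 for the additional flow.\<close>

locale filtered_derivation =
  fixes d :: "'b::{comm_ring_1,real_algebra_1} tseries \<Rightarrow> 'b tseries" and e :: int
  assumes add: "d (f + g) = d f + d g"
    and leibniz: "d (f * g) = d f * g + f * d g"
    and filt: "f \<in> filt w \<Longrightarrow> d f \<in> filt (w - e)"
begin

lemma zero [simp]: "d 0 = 0"
  using add[of 0 0] by simp

lemma uminus: "d (- f) = - d f"
  using add[of f "- f"] by (simp add: eq_neg_iff_add_eq_0 add.commute)

lemma diff: "d (f - g) = d f - d g"
  using add[of f "- g"] by (simp add: uminus)

lemma one [simp]: "d 1 = 0"
  using leibniz[of 1 1] by simp

lemma of_nat [simp]: "d (of_nat n) = 0"
  by (induction n) (auto simp: add)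

lemma of_int [simp]: "d (of_int n) = 0"
  by (cases n) (auto simp: uminus diff)

lemma power_const: "d f = 0 \<Longrightarrow> d (f ^ n) = 0"
  by (induction n) (auto simp: leibniz)

lemma scaleR_of_int: "d (of_int n *\<^sub>R f) = of_int n *\<^sub>R d f"
  using leibniz[of "of_int n" f] by (simp add: scaleR_conv_of_real)

text \<open>Derivations are not assumed linear over the reals. They kill the integers, so they are
  linear over the rationals: multiply by the denominator and cancel. Binomial coefficients and
  inverse factorials are rational.\<close>

lemma scaleR_Rats:
  assumes "r \<in> \<rat>"
  shows "d (r *\<^sub>R f) = r *\<^sub>R d f"
proof -
  obtain a b where ab: "r = of_int a / of_int b" "b \<noteq> 0"
    using assms by (auto elim: Rats_cases')
  have "of_int b *\<^sub>R d (r *\<^sub>R f) = d (of_int a *\<^sub>R f)"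
    using ab by (simp add: scaleR_of_int[symmetric])
  also have "\<dots> = of_int b *\<^sub>R (r *\<^sub>R d f)"
    using ab by (simp add: scaleR_of_int)
  finally show ?thesis
    using ab(2) by (metis of_int_eq_0_iff scaleR_left_imp_eq)
qed

lemma formal_sum: "fsummable f \<Longrightarrow> d (formal_sum f) = formal_sum (\<lambda>i. d (f i))"
  by (rule formal_sum_additive[where e = e]) (auto simp: add filt)

end

text \<open>By continuity, each coefficient of \<open>d f\<close> depends on finitely many monomials
  of \<open>f\<close>; on a monomial, the Leibniz rule peels off one variable at a time.\<close>

lemma continuous_derivation_filt:
  assumes d: "continuous_derivation d" and e: "0 \<le> e"
    and V: "\<And>i. d (Var i) \<in> filt (int (var_weight i) - e)"
    and f: "f \<in> filt w"
  shows "d f \<in> filt (w - e)"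
proof -
  define mon where "mon k c = TSeries (\<lambda>m. if m = k then c else 0)" for k and c :: 'a
  have add: "d (f + g) = d f + d g" and leib: "d (f * g) = d f * g + f * d g" for f g
    using d by (auto simp: continuous_derivation_def)
  have mon_Var: "mon (Poly_Mapping.single i 1 + k) c = Var i * mon k c" for i k c
  proof (rule tseries_eqI)
    fix m
    have "tcoeff (Var i * mon k c) m =
        (\<Sum>p\<in>splits m. if p = (Poly_Mapping.single i 1, k) then c else 0)"
      unfolding times_tseries_def Var_def mon_def tcoeff_TSeries
      by (intro sum.cong refl) (simp add: case_prod_beta prod_eq_iff)
    also have "\<dots> = (if (Poly_Mapping.single i 1, k) \<in> splits m then c else 0)"
      by (subst sum.delta) auto
    also have "\<dots> = tcoeff (mon (Poly_Mapping.single i 1 + k) c) m"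
      by (auto simp: mon_def splits_def)
    finally show "tcoeff (mon (Poly_Mapping.single i 1 + k) c) m = tcoeff (Var i * mon k c) m"
      by simp
  qed
  have mon_filt: "mon k c \<in> filt (int (weight k))" for k c
    by (simp add: mon_def filt_def)
  have dmon: "d (mon k c) \<in> filt (int (weight k) - e)" for k c
  proof (induction "weight k" arbitrary: k rule: less_induct)
    case less
    show ?case
    proof (cases "k = 0")
      case True
      \<comment> \<open>A constant from \<open>'b\<close> may have any derivative, but its weight is
        0 and the target index \<open>- e\<close> is nonpositive.\<close>
      then show ?thesis
        using e by (simp add: filt_nonpos)
    next
      case False
      then obtain i where i: "Poly_Mapping.lookup k i \<noteq> 0"
        by (metis lookup_zero poly_mapping_eqI)
      define k' where "k' = k - Poly_Mapping.single i 1"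
      have k: "k = Poly_Mapping.single i 1 + k'"
        unfolding k'_def
        by (rule poly_mapping_eqI)
          (use i in \<open>auto simp: lookup_add lookup_minus lookup_single when_def\<close>)
      then have w: "weight k = var_weight i + weight k'"
        by (simp only: weight_add weight_single)
      have IH: "d (mon k' c) \<in> filt (int (weight k') - e)"
        using less w var_weight_pos[of i] by simp
      have "d (mon k c) = d (Var i) * mon k' c + Var i * d (mon k' c)"
        using k leib mon_Var by metis
      moreover have "d (Var i) * mon k' c \<in> filt (int (weight k) - e)"
        using filt_mult[OF V[of i] mon_filt[of k' c]] w by (simp add: algebra_simps)
      moreover have "Var i * d (mon k' c) \<in> filt (int (weight k) - e)"
        using filt_mult[OF filt_Var[of i] IH] w by (simp add: algebra_simps)
      ultimately show ?thesis
        by (simp add: filt_add)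
    qed
  qed
  have zero: "d 0 = 0"
    using add[of 0 0] by simp
  have "w - e \<le> int (weight m)" if m: "tcoeff (d f) m \<noteq> 0" for m
  proof -
    obtain K where K: "finite K" "\<And>f. (\<forall>k\<in>K. tcoeff f k = 0) \<Longrightarrow> tcoeff (d f) m = 0"
      using d unfolding continuous_derivation_def by meson
    \<comment> \<open>Truncating \<open>f\<close> to the monomials that control the coefficient at
      \<open>m\<close> does not change that coefficient of the derivative.\<close>
    define g where "g = (\<Sum>k\<in>K. mon k (tcoeff f k))"
    have tsum: "tcoeff (sum h J) k = (\<Sum>i\<in>J. tcoeff (h i) k)" if "finite J"
      for h :: "_ \<Rightarrow> 'a tseries" and J :: "(nat \<Rightarrow>\<^sub>0 nat) set" and k
      using that by induction (auto simp: zero_tseries_def plus_tseries_def)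
    have "tcoeff (f - g) k = 0" if "k \<in> K" for k
      using that K(1) by (simp add: minus_tseries_def g_def tsum mon_def)
    then have "tcoeff (d (f - g)) m = 0"
      by (intro K(2)) auto
    moreover have "d f = d (f - g) + d g"
      using add[of "f - g" g] by simp
    ultimately have "tcoeff (d g) m \<noteq> 0"
      using m by (simp add: plus_tseries_def)
    moreover have "d g = (\<Sum>k\<in>K. d (mon k (tcoeff f k)))"
      unfolding g_def using K(1) by induction (auto simp: zero add)
    moreover have "d (mon k (tcoeff f k)) \<in> filt (w - e)" for k
    proof (cases "tcoeff f k = 0")
      case True
      then have "mon k (tcoeff f k) = 0"
        by (simp add: mon_def zero_tseries_def)
      then show ?thesis
        by (simp add: zero)
    next
      case False
      then have "w \<le> int (weight k)"
        using f by (simp add: filt_def)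
      then show ?thesis
        by (intro filt_mono[OF dmon]) simp
    qed
    ultimately have "d g \<in> filt (w - e)"
      by (simp add: filt_sum)
    then show ?thesis
      using \<open>tcoeff (d g) m \<noteq> 0\<close> by (simp add: filt_def)
  qed
  then show ?thesis
    by (simp add: filt_def)
qed

lemma filtered_derivationI:
  assumes "continuous_derivation d" "0 \<le> e"
    and "\<And>i. d (Var i) \<in> filt (int (var_weight i) - e)"
  shows "filtered_derivation d e"
proof unfold_locales
  show "d (f + g) = d f + d g" "d (f * g) = d f * g + f * d g" for f g
    using assms(1) by (auto simp: continuous_derivation_def)
  show "d f \<in> filt (w - e)" if "f \<in> filt w" for f w
    using assms that by (rule continuous_derivation_filt)
qed

subsection \<open>Admissible operators\<close>

definition ops :: "int \<Rightarrow> 'b::comm_ring_1 psdo set" where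
  "ops c = {A. \<forall>i. A i \<in> filt (2 * i + c)}"

lemma opsD: "A \<in> ops c \<Longrightarrow> A i \<in> filt (2 * i + c)"
  by (simp add: ops_def)

lemma ops_mono: "A \<in> ops c \<Longrightarrow> c' \<le> c \<Longrightarrow> A \<in> ops c'"
  unfolding ops_def by (auto intro: filt_mono)

lemma ops_add: "A \<in> ops c \<Longrightarrow> B \<in> ops c \<Longrightarrow> A + B \<in> ops c"
  by (simp add: ops_def filt_add)

lemma ops_uminus: "A \<in> ops c \<Longrightarrow> - A \<in> ops c"
  by (simp add: ops_def filt_uminus)

text \<open>The bound \<open>2 * i\<close> is vacuous for i \<le> 0.\<close>

lemma ops_nonpos_order: "(\<And>n. n > 0 \<Longrightarrow> A n = 0) \<Longrightarrow> A \<in> ops 0"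
  unfolding ops_def by (smt (verit) filt_0 filt_nonpos mem_Collect_eq)

definition adm :: "'b::comm_ring_1 psdo \<Rightarrow> bool" where
  "adm A \<longleftrightarrow> (\<exists>c. A \<in> ops c)"

lemma admI: "A \<in> ops c \<Longrightarrow> adm A"
  by (auto simp: adm_def)

lemma adm_add [simp]: "adm A \<Longrightarrow> adm B \<Longrightarrow> adm (A + B)"
  unfolding adm_def by (meson min.cobounded1 min.cobounded2 ops_add ops_mono)

lemma adm_uminus [simp]: "adm A \<Longrightarrow> adm (- A)"
  unfolding adm_def by (meson ops_uminus)

lemma adm_diff [simp]: "adm A \<Longrightarrow> adm B \<Longrightarrow> adm (A - B)"
  using adm_add[of A "- B"] by simp

text \<open>A product lies in \<open>filt w\<close> as soon as one factor does. In this form,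
  failure of membership yields the inequalities on indices that leave only finitely many
  terms.\<close>

lemma filt_factor:
  assumes "r *\<^sub>R (f * g) \<notin> filt w" "f \<in> filt a" "g \<in> filt b"
  shows "a < w \<and> b < w"
  using assms by (meson filt_mono filt_mult_left filt_mult_right filt_scaleR linorder_not_less)

text \<open>
  Equates the coefficients of \<open>A\<^sub>i \<partial>\<^sup>u(B\<^sub>j) \<partial>\<^sup>t(C\<^sub>k)\<close> in \<open>A (B C)\<close> and in \<open>(A B) C\<close>.
\<close>

lemma gbinomial_pairs_identity:
  fixes a b :: real
  shows "(\<Sum>s\<le>t. (a gchoose (u + t - s)) * (b gchoose s) * real (u + t - s choose u)) =
    (a gchoose u) * (a + b - real u gchoose t)"
proof -
  \<comment> \<open>Trinomial revision extracts \<open>a gchoose u\<close>; the remaining sum over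
    \<open>s\<close> is a Vandermonde convolution.\<close>
  have "(a gchoose (u + t - s)) * (b gchoose s) * real (u + t - s choose u) =
      (a gchoose u) * ((b gchoose s) * (a - real u gchoose (t - s)))" if "s \<le> t" for s
  proof -
    have "(a gchoose (u + t - s)) * (real (u + t - s) gchoose u) =
        (a gchoose u) * (a - real u gchoose (u + t - s - u))"
      using gbinomial_trinomial_revision[of u "u + t - s" a] that by simp
    moreover have "u + t - s - u = t - s"
      by simp
    ultimately show ?thesis
      by (simp add: binomial_gbinomial mult_ac)
  qed
  then have "(\<Sum>s\<le>t. (a gchoose (u + t - s)) * (b gchoose s) * real (u + t - s choose u)) =
      (a gchoose u) * (\<Sum>s\<le>t. (b gchoose s) * (a - real u gchoose (t - s)))"
    unfolding sum_distrib_left by (intro sum.cong refl) blast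
  also have "(\<Sum>s\<le>t. (b gchoose s) * (a - real u gchoose (t - s))) = (b + (a - real u) gchoose t)"
    by (simp add: gbinomial_Vandermonde atMost_atLeast0)
  finally show ?thesis
    by (simp add: algebra_simps)
qed

text \<open>Allows derivations to move past the coefficients of the product by
  \<open>scaleR_Rats\<close>.\<close>

lemma gbinomial_of_int_Rats: "real_of_int i gchoose r \<in> \<rat>"
proof -
  have "(\<Prod>j = 0..<r. real_of_int i - real j) \<in> \<rat>"
    by (induction r) auto
  moreover have "fact r \<in> (\<rat> :: real set)"
    by (metis Rats_of_nat of_nat_fact)
  ultimately show ?thesis
    by (simp add: gbinomial_prod_rev)
qed

subsection \<open>The algebra of admissible operators\<close>

locale psdo_algebra = filtered_derivation d 1
  for d :: "'b::{comm_ring_1,real_algebra_1} tseries \<Rightarrow> 'b tseries"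
begin

abbreviation mult (infixl "\<odot>" 70) where
  "A \<odot> B \<equiv> psdo_mult d A B"

lemma pow_add: "(d ^^ r) (f + g) = (d ^^ r) f + (d ^^ r) g"
  by (induction r) (auto simp: add)

lemma pow_0 [simp]: "(d ^^ r) 0 = 0"
  by (induction r) auto

lemma pow_scaleR_Rats: "q \<in> \<rat> \<Longrightarrow> (d ^^ r) (q *\<^sub>R f) = q *\<^sub>R (d ^^ r) f"
  by (induction r) (auto simp: scaleR_Rats)

lemma pow_const: "d f = 0 \<Longrightarrow> (d ^^ r) f = (if r = 0 then f else 0)"
  by (induction r) auto

lemma pow_const_mult: "d a = 0 \<Longrightarrow> (d ^^ r) (a * f) = a * (d ^^ r) f"
  by (induction r) (auto simp: leibniz)

lemma pow_filt: "f \<in> filt w \<Longrightarrow> (d ^^ r) f \<in> filt (w - int r)"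
proof (induction r)
  case (Suc r)
  then show ?case
    using filt[of "(d ^^ r) f" "w - int r"] by (simp add: algebra_simps)
qed simp

lemma pow_formal_sum:
  "fsummable f \<Longrightarrow> (d ^^ r) (formal_sum f) = formal_sum (\<lambda>i. (d ^^ r) (f i))"
  by (rule formal_sum_additive[where e = "int r"]) (auto simp: pow_add pow_filt)

lemma pow_leibniz:
  "(d ^^ r) (f * g) = (\<Sum>u\<le>r. real (r choose u) *\<^sub>R ((d ^^ u) f * (d ^^ (r - u)) g))"
proof (induction r)
  case (Suc r)
  let ?x = "\<lambda>u. (d ^^ u) f" and ?y = "\<lambda>u. (d ^^ u) g"
  have d_sum: "d (sum h I) = (\<Sum>i\<in>I. d (h i))" if "finite I" for h and I :: "nat set"
    using that by induction (auto simp: add)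
  \<comment> \<open>The shifted sum may keep the upper limit \<open>r\<close> because
    \<open>r choose Suc r\<close> is 0; Pascal's rule can then merge the two sums term by
    term.\<close>
  have shift: "(\<Sum>u\<le>r. real (r choose u) *\<^sub>R (?x u * ?y (Suc r - u))) =
      f * ?y (Suc r) + (\<Sum>u\<le>r. real (r choose Suc u) *\<^sub>R (?x (Suc u) * ?y (r - u)))"
  proof (cases r)
    case (Suc m)
    have "(\<Sum>u\<le>Suc m. real (r choose u) *\<^sub>R (?x u * ?y (Suc r - u))) =
        f * ?y (Suc r) + (\<Sum>u\<le>m. real (r choose Suc u) *\<^sub>R (?x (Suc u) * ?y (r - u)))"
      by (subst sum.atMost_Suc_shift) simp
    then show ?thesis
      using Suc by (simp add: binomial_eq_0)
  qed simp
  have "(d ^^ Suc r) (f * g) =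
      (\<Sum>u\<le>r. real (r choose u) *\<^sub>R (?x (Suc u) * ?y (r - u) + ?x u * ?y (Suc r - u)))"
    by (simp add: Suc d_sum scaleR_Rats leibniz Suc_diff_le)
  also have "\<dots> = (\<Sum>u\<le>r. real (r choose u) *\<^sub>R (?x (Suc u) * ?y (r - u))) +
      (f * ?y (Suc r) + (\<Sum>u\<le>r. real (r choose Suc u) *\<^sub>R (?x (Suc u) * ?y (r - u))))"
    by (simp only: scaleR_add_right sum.distrib shift)
  also have "\<dots> = f * ?y (Suc r) +
      (\<Sum>u\<le>r. real (Suc r choose Suc u) *\<^sub>R (?x (Suc u) * ?y (r - u)))"
    by (simp add: scaleR_add_left sum.distrib)
  also have "\<dots> = (\<Sum>u\<le>Suc r. real (Suc r choose u) *\<^sub>R (?x u * ?y (Suc r - u)))"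
    by (subst sum.atMost_Suc_shift) simp
  finally show ?case .
qed simp

section \<open>Convergence and bilinearity of the product\<close>

lemma pow_ops: "A \<in> ops c \<Longrightarrow> (d ^^ r) (A j) \<in> filt (2 * j + c - int r)"
  by (intro pow_filt opsD)

definition mult_term :: "'b psdo \<Rightarrow> 'b psdo \<Rightarrow> int \<Rightarrow> int \<times> nat \<Rightarrow> 'b tseries" where
  "mult_term A B n = (\<lambda>(i, r). (real_of_int i gchoose r) *\<^sub>R (A i * (d ^^ r) (B (n - i + int r))))"

lemma mult_eq: "(A \<odot> B) n = formal_sum (mult_term A B n)"
  by (simp add: psdo_mult_def mult_term_def)

text \<open>The factor \<open>A i\<close> bounds i above. The other factor gives 2(n - i) + r + b <
  w, which bounds i below and, with the first bound, r above.\<close>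

lemma fsummable_mult_term:
  assumes "A \<in> ops a" "B \<in> ops b"
  shows "fsummable (mult_term A B n)"
  unfolding fsummable_def
proof
  fix w
  define N where "N = \<bar>w\<bar> + \<bar>a\<bar> + \<bar>b\<bar> + 2 * \<bar>n\<bar>"
  have "{p. mult_term A B n p \<notin> filt w} \<subseteq> {- N..N} \<times> {..nat (4 * N)}"
  proof clarify
    fix i r assume "mult_term A B n (i, r) \<notin> filt w"
    then have "(real_of_int i gchoose r) *\<^sub>R (A i * (d ^^ r) (B (n - i + int r))) \<notin> filt w"
      by (simp add: mult_term_def)
    from filt_factor[OF this opsD[OF assms(1)] pow_ops[OF assms(2)]]
    show "i \<in> {- N..N} \<and> r \<in> {..nat (4 * N)}"
      by (auto simp: N_def)
  qed
  then show "finite {p. mult_term A B n p \<notin> filt w}"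
    by (rule finite_subset) auto
qed

lemma adm_fsummable: "adm A \<Longrightarrow> adm B \<Longrightarrow> fsummable (mult_term A B n)"
  by (auto simp: adm_def intro: fsummable_mult_term)

text \<open>The weights add up to (2i + a) + (2(n - i + r) + b - r) = 2n + a + b + r, with a surplus
  of r.\<close>

lemma mult_term_filt:
  assumes "A \<in> ops a" "B \<in> ops b"
  shows "mult_term A B n p \<in> filt (2 * n + (a + b))"
proof (cases p)
  case (Pair i r)
  have "(real_of_int i gchoose r) *\<^sub>R (A i * (d ^^ r) (B (n - i + int r))) \<in> filt (2 * n + (a + b))"
    by (rule filt_mono[OF filt_scaleR[OF filt_mult[OF opsD[OF assms(1)] pow_ops[OF assms(2)]]]]) simp
  then show ?thesis
    by (simp add: mult_term_def Pair)
qed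

lemma mult_ops: "A \<in> ops a \<Longrightarrow> B \<in> ops b \<Longrightarrow> A \<odot> B \<in> ops (a + b)"
  unfolding ops_def[of "a + b"] mult_eq by (auto intro!: filt_formal_sum mult_term_filt)

lemma adm_mult [simp]: "adm A \<Longrightarrow> adm B \<Longrightarrow> adm (A \<odot> B)"
  unfolding adm_def using mult_ops by blast

lemma mult_add_right:
  assumes "adm A" "adm B" "adm C"
  shows "A \<odot> (B + C) = A \<odot> B + A \<odot> C"
proof
  fix n
  have "mult_term A (B + C) n = (\<lambda>p. mult_term A B n p + mult_term A C n p)"
    by (auto simp: mult_term_def pow_add distrib_left scaleR_add_right)
  then show "(A \<odot> (B + C)) n = (A \<odot> B + A \<odot> C) n"
    using assms by (simp add: mult_eq formal_sum_add adm_fsummable)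
qed

lemma mult_add_left:
  assumes "adm A" "adm B" "adm C"
  shows "(A + B) \<odot> C = A \<odot> C + B \<odot> C"
proof
  fix n
  have "mult_term (A + B) C n = (\<lambda>p. mult_term A C n p + mult_term B C n p)"
    by (auto simp: mult_term_def distrib_right scaleR_add_right)
  then show "((A + B) \<odot> C) n = (A \<odot> C + B \<odot> C) n"
    using assms by (simp add: mult_eq formal_sum_add adm_fsummable)
qed

lemma mult_zero [simp]: "A \<odot> 0 = 0" "0 \<odot> A = 0"
proof -
  have "mult_term A 0 n = (\<lambda>p. 0)" "mult_term 0 A n = (\<lambda>p. 0)" for n
    by (auto simp: mult_term_def)
  then show "A \<odot> 0 = 0" "0 \<odot> A = 0"
    by (auto simp: mult_eq)
qed

lemma mult_uminus_right: "adm A \<Longrightarrow> adm B \<Longrightarrow> A \<odot> (- B) = - (A \<odot> B)"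
  using mult_add_right[of A B "- B"] by (simp add: eq_neg_iff_add_eq_0 add.commute)

lemma mult_uminus_left: "adm A \<Longrightarrow> adm B \<Longrightarrow> (- A) \<odot> B = - (A \<odot> B)"
  using mult_add_left[of A "- A" B] by (simp add: eq_neg_iff_add_eq_0 add.commute)

lemma mult_diff_right: "adm A \<Longrightarrow> adm B \<Longrightarrow> adm C \<Longrightarrow> A \<odot> (B - C) = A \<odot> B - A \<odot> C"
  using mult_add_right[of A B "- C"] by (simp add: mult_uminus_right)

lemma mult_diff_left: "adm A \<Longrightarrow> adm B \<Longrightarrow> adm C \<Longrightarrow> (A - B) \<odot> C = A \<odot> C - B \<odot> C"
  using mult_add_left[of A "- B" C] by (simp add: mult_uminus_left)

text \<open>Both triple products are expanded into the terms \<open>T\<close>, indexed by the orders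
  i, j and by the numbers u, t of derivatives falling on the coefficients of \<open>B\<close> and
  \<open>C\<close>. In (A B) C a term has the coefficient in \<open>H\<close>. In A (B C) its
  contributions \<open>H'\<close> are further indexed by the number s of derivatives of
  \<open>C\<close> that come from \<partial>^j, and \<open>gbinomial_pairs_identity\<close> sums
  them to \<open>H\<close>.\<close>

lemma mult_assoc:
  assumes "adm A" "adm B" "adm C"
  shows "A \<odot> B \<odot> C = A \<odot> (B \<odot> C)"
proof
  fix n
  obtain a b c where ops: "A \<in> ops a" "B \<in> ops b" "C \<in> ops c"
    using assms by (auto simp: adm_def)
  define T where "T = (\<lambda>(i, j, u, t). A i * ((d ^^ u) (B j) *
      (d ^^ t) (C (n - i - j + int u + int t))))"
  define H where "H = (\<lambda>(i, j, u, t). ((real_of_int i gchoose u) *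
      (real_of_int i + real_of_int j - real u gchoose t)) *\<^sub>R T (i, j, u, t))"
  define H' where "H' = (\<lambda>(i, j, u, t) s. if s \<le> t then
      ((real_of_int i gchoose (u + t - s)) * (real_of_int j gchoose s) * real (u + t - s choose u))
        *\<^sub>R T (i, j, u, t) else 0)"
  \<comment> \<open>The scalar \<open>q\<close> is arbitrary so that one bound serves both
    \<open>H\<close> and \<open>H'\<close>.\<close>
  have T_bound: "\<exists>N. \<forall>i j u t q. q *\<^sub>R T (i, j, u, t) \<notin> filt w \<longrightarrow>
      i \<in> {- N..N} \<and> j \<in> {- N..N} \<and> u \<in> {..nat N} \<and> t \<in> {..nat N}" for w
  proof -
    \<comment> \<open>The three inequalities derived below add up to u + t < 3w - a - b - c - 2n.
      This bounds u and t, and then i and j on both sides; the factor 100 is merely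
      generous.\<close>
    define N where "N = 100 * (\<bar>w\<bar> + \<bar>a\<bar> + \<bar>b\<bar> + \<bar>c\<bar> + \<bar>n\<bar>)"
    have "i \<in> {- N..N} \<and> j \<in> {- N..N} \<and> u \<in> {..nat N} \<and> t \<in> {..nat N}"
      if *: "q *\<^sub>R T (i, j, u, t) \<notin> filt w" for i j u t q
    proof -
      let ?b = "(d ^^ u) (B j)" and ?c = "(d ^^ t) (C (n - i - j + int u + int t))"
      have 1: "2 * i + a < w"
        using filt_factor[of q "A i" "?b * ?c" w "2 * i + a" "0 + 0"] * opsD[OF ops(1), of i]
        by (auto simp: T_def intro: filt_mult filt_nonpos)
      have "1 *\<^sub>R (?b * ?c) \<notin> filt w"
        using * by (auto simp: T_def intro: filt_scaleR filt_mult_left)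
      from filt_factor[OF this pow_ops[OF ops(2)] pow_ops[OF ops(3)]]
      have 2: "2 * j + b - int u < w"
        "2 * (n - i - j + int u + int t) + c - int t < w"
        by auto
      show ?thesis
        using 1 2 unfolding N_def by auto
    qed
    then show ?thesis by blast
  qed
  have sum_H: "fsummable H"
    unfolding fsummable_def
  proof
    fix w
    obtain N where N: "\<forall>i j u t q. q *\<^sub>R T (i, j, u, t) \<notin> filt w \<longrightarrow>
        i \<in> {- N..N} \<and> j \<in> {- N..N} \<and> u \<in> {..nat N} \<and> t \<in> {..nat N}"
      using T_bound by blast
    have "{x. H x \<notin> filt w} \<subseteq> {- N..N} \<times> {- N..N} \<times> {..nat N} \<times> {..nat N}"
    proof
      fix x assume "x \<in> {x. H x \<notin> filt w}"
      then obtain i j u t where x: "x = (i, j, u, t)" and "H (i, j, u, t) \<notin> filt w"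
        by (cases x) auto
      then have "i \<in> {- N..N} \<and> j \<in> {- N..N} \<and> u \<in> {..nat N} \<and> t \<in> {..nat N}"
        using N unfolding H_def prod.case by blast
      then show "x \<in> {- N..N} \<times> {- N..N} \<times> {..nat N} \<times> {..nat N}"
        by (simp add: x)
    qed
    then show "finite {x. H x \<notin> filt w}"
      by (rule finite_subset) auto
  qed
  have sum_H': "fsummable (\<lambda>(x, s). H' x s)"
    unfolding fsummable_def
  proof
    fix w
    obtain N where N: "\<forall>i j u t q. q *\<^sub>R T (i, j, u, t) \<notin> filt w \<longrightarrow>
        i \<in> {- N..N} \<and> j \<in> {- N..N} \<and> u \<in> {..nat N} \<and> t \<in> {..nat N}"
      using T_bound by blast
    have "{p. (case p of (x, s) \<Rightarrow> H' x s) \<notin> filt w} \<subseteq>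
        ({- N..N} \<times> {- N..N} \<times> {..nat N} \<times> {..nat N}) \<times> {..nat N}"
    proof
      fix p assume p: "p \<in> {p. (case p of (x, s) \<Rightarrow> H' x s) \<notin> filt w}"
      obtain i j u t s where ps: "p = ((i, j, u, t), s)"
        by (metis prod.exhaust)
      with p have *: "H' (i, j, u, t) s \<notin> filt w"
        by simp
      then have "s \<le> t"
        by (auto simp: H'_def split: if_splits)
      moreover from this have "i \<in> {- N..N} \<and> j \<in> {- N..N} \<and> u \<in> {..nat N} \<and> t \<in> {..nat N}"
        using * N unfolding H'_def prod.case by (metis (no_types, lifting))
      ultimately show "p \<in> ({- N..N} \<times> {- N..N} \<times> {..nat N} \<times> {..nat N}) \<times> {..nat N}"
        by (auto simp: ps)
    qed
    then show "finite {p. (case p of (x, s) \<Rightarrow> H' x s) \<notin> filt w}"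
      by (rule finite_subset) auto
  qed
  have H_eq: "formal_sum (H' x) = H x" for x
  proof -
    obtain i j u t where x: "x = (i, j, u, t)"
      by (metis prod_cases4)
    have "formal_sum (H' x) = sum (H' x) {..t}"
      by (rule formal_sum_finite) (auto simp: H'_def x)
    also have "\<dots> = H x"
      by (simp add: H'_def H_def x scaleR_sum_left[symmetric] gbinomial_pairs_identity)
    finally show ?thesis .
  qed
  have left: "(A \<odot> B \<odot> C) n = formal_sum H"
  proof -
    define Q where "Q = (\<lambda>(i', s) (i, r). (real_of_int i' gchoose s) *\<^sub>R
        ((real_of_int i gchoose r) *\<^sub>R (A i * (d ^^ r) (B (i' - i + int r))) *
         (d ^^ s) (C (n - i' + int s))))"
    \<comment> \<open>The order at which the product of \<open>A\<close> and \<open>B\<close>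
      contributes is i' = i + j - u.\<close>
    let ?i = "\<lambda>(i, j, u, t). ((i + j - int u, t), (i, u))"
    let ?j = "\<lambda>((i', s), (i, r)). (i, i' - i + int r, r, s)"
    have QH: "H (?j x) = (\<lambda>(p, q). Q p q) x" for x
      by (auto simp: H_def Q_def T_def case_prod_beta mult.assoc algebra_simps)
    have ij: "?i (?j x) = x" "?j (?i y) = y" for x y
      by (auto simp: case_prod_beta)
    have HQ: "(\<lambda>(p, q). Q p q) (?i y) = H y" for y
      using QH[of "?i y"] ij(2)[of y] by simp
    have sum_Q: "fsummable (\<lambda>(p, q). Q p q)"
      by (rule fsummable_witness[OF sum_H, where i = ?i and j = ?j]) (use ij(1) QH in simp)
    have "(A \<odot> B \<odot> C) n = formal_sum (\<lambda>p. formal_sum (Q p))"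
      unfolding psdo_mult_def[of d "A \<odot> B"]
    proof (rule arg_cong[of _ _ formal_sum], rule ext, clarify)
      fix i' s
      show "(real_of_int i' gchoose s) *\<^sub>R ((A \<odot> B) i' * (d ^^ s) (C (n - i' + int s))) =
          formal_sum (Q (i', s))"
      proof -
        have "(\<lambda>q. (real_of_int i' gchoose s) *\<^sub>R (mult_term A B i' q * (d ^^ s) (C (n - i' + int s)))) =
            Q (i', s)"
          by (auto simp: mult_term_def Q_def)
        moreover have "fsummable (\<lambda>q. mult_term A B i' q * (d ^^ s) (C (n - i' + int s)))"
          by (rule fsummable_additive[where e = 0, OF _ fsummable_mult_term[OF ops(1,2)]])
            (auto intro: filt_mult_right)
        ultimately show ?thesis
          by (simp add: mult_eq formal_sum_mult_right[OF fsummable_mult_term[OF ops(1,2)]]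
              formal_sum_scaleR)
      qed
    qed
    also have "\<dots> = formal_sum (\<lambda>(p, q). Q p q)"
      by (rule formal_sum_pair[OF sum_Q])
    also have "\<dots> = formal_sum H"
      by (rule formal_sum_witness[where i = ?i and j = ?j]) (use ij QH HQ in simp_all)
    finally show ?thesis .
  qed
  have right: "(A \<odot> (B \<odot> C)) n = formal_sum (\<lambda>(x, s). H' x s)"
  proof -
    \<comment> \<open>The Leibniz rule for \<partial>^r puts u derivatives on \<open>B\<close> and r
      - u on \<open>C\<close>; with the s already there, \<open>C\<close> carries t = r - u + s.
      Hence u \<le> r corresponds to s \<le> t.\<close>
    define K where "K = (\<lambda>((i, r), (j, s)) u. if u \<le> r then
      (real_of_int i gchoose r) *\<^sub>R (A i * ((real_of_int j gchoose s) *\<^sub>R (real (r choose u) *\<^sub>R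
        ((d ^^ u) (B j) * (d ^^ (r - u)) ((d ^^ s) (C (n - i + int r - j + int s))))))) else 0)"
    let ?i = "\<lambda>((i, j, u, t), s). (((i, u + t - s), (j, s)), u)"
    let ?j = "\<lambda>(((i, r), (j, s)), u). ((i, j, u, r - u + s), s)"
    have nzK: "u \<le> r" if "K ((i, r), (j, s)) u \<noteq> 0" for i r j s u
      using that by (auto simp: K_def split: if_splits)
    have nzH: "s \<le> t" if "H' (i, j, u, t) s \<noteq> 0" for i j u t s
      using that by (auto simp: H'_def split: if_splits)
    have KH: "K ((i, r), (j, s)) u = H' (i, j, u, r - u + s) s" if le: "u \<le> r" for i r j s u
    proof -
      obtain v where r: "r = u + v"
        using le_Suc_ex[OF le] by blast
      have "n - i + int r - j + int s = n - i - j + int u + int (v + s)"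
        by (simp add: r)
      then have "(d ^^ (r - u)) ((d ^^ s) (C (n - i + int r - j + int s))) =
          (d ^^ (v + s)) (C (n - i - j + int u + int (v + s)))"
        unfolding r by (simp only: funpow_add o_apply diff_add_inverse)
      moreover have "u + (v + s) - s = r" "r - u + s = v + s"
        by (simp_all add: r)
      ultimately show ?thesis
        using that by (simp add: K_def H'_def T_def)
    qed
    have 1: "?i (?j x) = x \<and> (\<lambda>(y, s). H' y s) (?j x) = (\<lambda>(y, u). K y u) x"
      if "(\<lambda>(y, u). K y u) x \<noteq> 0" for x
    proof -
      obtain i r j s u where x: "x = (((i, r), (j, s)), u)"
        by (metis prod.exhaust)
      with that have "u \<le> r"
        using nzK by simp
      then show ?thesis
        using KH[of u r i j s] by (simp add: x)
    qed
    have 2: "?j (?i x) = x \<and> (\<lambda>(y, u). K y u) (?i x) = (\<lambda>(y, s). H' y s) x"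
      if "(\<lambda>(y, s). H' y s) x \<noteq> 0" for x
    proof -
      obtain i j u t s where x: "x = ((i, j, u, t), s)"
        by (metis prod.exhaust)
      with that have "s \<le> t"
        using nzH by simp
      then show ?thesis
        using KH[of u "u + t - s" i j s] by (simp add: x)
    qed
    have sum_K: "fsummable (\<lambda>(y, u). K y u)"
      by (rule fsummable_witness[OF sum_H', where i = ?i and j = ?j]) (rule 1)
    have eta: "(\<lambda>(p, q). formal_sum (K (p, q))) = (\<lambda>y. formal_sum (K y))"
      by auto
    have sum_K': "fsummable (\<lambda>(p, q). formal_sum (K (p, q)))"
      unfolding eta by (rule fsummable_outer[OF sum_K])
    have "(A \<odot> (B \<odot> C)) n = formal_sum (\<lambda>p. formal_sum (\<lambda>q. formal_sum (K (p, q))))"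
      unfolding psdo_mult_def[of d A]
    proof (rule arg_cong[of _ _ formal_sum], rule ext, clarify)
      fix i r
      let ?BC = "\<lambda>(j, s). (real_of_int j gchoose s) *\<^sub>R
        (B j * (d ^^ s) (C (n - i + int r - j + int s)))"
      have sum_BC: "fsummable ?BC"
        using fsummable_mult_term[OF ops(2,3), of "n - i + int r"]
        by (simp add: mult_term_def algebra_simps)
      have s1: "fsummable (\<lambda>q. (d ^^ r) (?BC q))"
        by (rule fsummable_additive[where e = "int r"]) (auto intro: pow_filt sum_BC)
      have s2: "fsummable (\<lambda>q. A i * (d ^^ r) (?BC q))"
        by (rule fsummable_additive[where e = 0, OF _ s1]) (auto intro: filt_mult_left)
      have "(real_of_int i gchoose r) *\<^sub>R (A i * (d ^^ r) ((B \<odot> C) (n - i + int r))) =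
          formal_sum (\<lambda>q. (real_of_int i gchoose r) *\<^sub>R (A i * (d ^^ r) (?BC q)))"
        unfolding psdo_mult_def
        by (simp only: pow_formal_sum[OF sum_BC] formal_sum_mult_left[OF s1] formal_sum_scaleR[OF s2])
      also have "\<dots> = formal_sum (\<lambda>q. formal_sum (K ((i, r), q)))"
      proof (rule arg_cong[of _ _ formal_sum], rule ext, clarify)
        fix j s
        have "formal_sum (K ((i, r), (j, s))) = sum (K ((i, r), (j, s))) {..r}"
          by (rule formal_sum_finite) (auto simp: K_def)
        also have "\<dots> = (real_of_int i gchoose r) *\<^sub>R (A i * (d ^^ r) ((real_of_int j gchoose s) *\<^sub>R
            (B j * (d ^^ s) (C (n - i + int r - j + int s)))))"
          by (simp add: K_def pow_scaleR_Rats[OF gbinomial_of_int_Rats] pow_leibniz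
              scaleR_sum_right sum_distrib_left)
        finally show "(real_of_int i gchoose r) *\<^sub>R (A i * (d ^^ r) ((real_of_int j gchoose s) *\<^sub>R
            (B j * (d ^^ s) (C (n - i + int r - j + int s))))) = formal_sum (K ((i, r), j, s))"
          by simp
      qed
      finally show "(real_of_int i gchoose r) *\<^sub>R (A i * (d ^^ r) ((B \<odot> C) (n - i + int r))) =
          formal_sum (\<lambda>q. formal_sum (K ((i, r), q)))" .
    qed
    also have "\<dots> = formal_sum (\<lambda>(p, q). formal_sum (K (p, q)))"
      by (rule formal_sum_pair[OF sum_K'])
    also have "\<dots> = formal_sum (\<lambda>y. formal_sum (K y))"
      by (simp only: eta)
    also have "\<dots> = formal_sum (\<lambda>(y, u). K y u)"
      by (rule formal_sum_pair[OF sum_K])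
    also have "\<dots> = formal_sum (\<lambda>(x, s). H' x s)"
      by (rule formal_sum_witness[where i = ?i and j = ?j]) (rule 1, assumption, rule 2, assumption)
    finally show ?thesis .
  qed
  have "formal_sum (\<lambda>(x, s). H' x s) = formal_sum H"
    using formal_sum_pair[OF sum_H'] by (simp add: H_eq)
  then show "(A \<odot> B \<odot> C) n = (A \<odot> (B \<odot> C)) n"
    using left right by simp
qed

end

subsection \<open>Formal sums of operators\<close>

definition opsum :: "('i \<Rightarrow> 'b::comm_ring_1 psdo) \<Rightarrow> 'b psdo" where
  "opsum F = (\<lambda>n. formal_sum (\<lambda>k. F k n))"

text \<open>The second condition is uniform in the order: outside a finite index set, all
  coefficients obey the bound at once. The first keeps the sum admissible.\<close>

definition opsummable :: "('i \<Rightarrow> 'b::comm_ring_1 psdo) \<Rightarrow> bool" where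
  "opsummable F \<longleftrightarrow> (\<exists>c. \<forall>k. F k \<in> ops c) \<and> (\<forall>c. finite {k. F k \<notin> ops c})"

lemma opsummable_adm: "opsummable F \<Longrightarrow> adm (F k)"
  by (auto simp: opsummable_def adm_def)

lemma opsummable_fsummable:
  assumes "opsummable F"
  shows "fsummable (\<lambda>k. F k n)"
  unfolding fsummable_def
proof
  fix w
  have "{k. F k n \<notin> filt w} \<subseteq> {k. F k \<notin> ops (w - 2 * n)}"
    by (auto dest: opsD[of _ _ n])
  then show "finite {k. F k n \<notin> filt w}"
    using assms finite_subset unfolding opsummable_def by blast
qed

lemma opsum_ops: "(\<And>k. F k \<in> ops c) \<Longrightarrow> opsum F \<in> ops c"
  unfolding ops_def opsum_def by (auto intro!: filt_formal_sum)

lemma opsum_adm: "opsummable F \<Longrightarrow> adm (opsum F)"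
  unfolding opsummable_def adm_def using opsum_ops by blast

lemma opsum_diff:
  "opsummable F \<Longrightarrow> opsummable G \<Longrightarrow> opsum (\<lambda>k. F k - G k) = opsum F - opsum G"
  by (rule ext) (simp add: opsum_def formal_sum_diff opsummable_fsummable)

lemma opsummableI:
  assumes "\<And>k. F k \<in> ops (h k)" "\<And>k. c \<le> h k" "\<And>c. finite {k. h k < c}"
  shows "opsummable F"
  unfolding opsummable_def
proof (intro conjI allI exI)
  show "F k \<in> ops c" for k
    using assms(1,2) by (rule ops_mono)
  have "{k. F k \<notin> ops c'} \<subseteq> {k. h k < c'}" for c'
  proof clarify
    fix k assume "F k \<notin> ops c'"
    then show "h k < c'"
      using ops_mono[OF assms(1), of c' k] by (meson not_less)
  qed
  then show "finite {k. F k \<notin> ops c'}" for c'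
    using assms(3) by (rule finite_subset)
qed

section \<open>Scalar multiples, and parts of nonnegative and negative order\<close>

definition smul :: "'b::comm_ring_1 tseries \<Rightarrow> 'b psdo \<Rightarrow> 'b psdo" where
  "smul a A = (\<lambda>n. a * A n)"

lemma smul_ops: "a \<in> filt w \<Longrightarrow> A \<in> ops c \<Longrightarrow> smul a A \<in> ops (w + c)"
  unfolding ops_def smul_def by (auto intro!: filt_mono[OF filt_mult])

lemma smul_diff: "smul a (A - B) = smul a A - smul a B"
  by (rule ext) (simp add: smul_def right_diff_distrib)

lemma minus_part_add: "psdo_minus_part (A + B) = psdo_minus_part A + psdo_minus_part B"
  by (rule ext) (simp add: psdo_minus_part_def psdo_plus_part_def)

lemma minus_part_diff: "psdo_minus_part (A - B) = psdo_minus_part A - psdo_minus_part B"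
  by (rule ext) (simp add: psdo_minus_part_def psdo_plus_part_def)

lemma plus_minus_part: "A = psdo_plus_part A + psdo_minus_part A"
  by (rule ext) (simp add: psdo_minus_part_def)

lemma minus_part_of_minus: "(\<And>n. n \<ge> 0 \<Longrightarrow> A n = 0) \<Longrightarrow> psdo_minus_part A = A"
  by (rule ext) (simp add: psdo_minus_part_def psdo_plus_part_def)

lemma minus_part_of_plus: "(\<And>n. n < 0 \<Longrightarrow> A n = 0) \<Longrightarrow> psdo_minus_part A = 0"
  by (rule ext) (simp add: psdo_minus_part_def psdo_plus_part_def)

lemma adm_plus_part [simp]: "adm A \<Longrightarrow> adm (psdo_plus_part A)"
  by (auto simp: adm_def ops_def psdo_plus_part_def)

lemma adm_minus_part [simp]: "adm A \<Longrightarrow> adm (psdo_minus_part A)"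
  by (auto simp: adm_def ops_def psdo_minus_part_def psdo_plus_part_def)

lemma monom_ops: "psdo_monom k \<in> ops (- 2 * k)"
  by (simp add: ops_def psdo_monom_def filt_nonpos)

lemma adm_monom [simp]: "adm (psdo_monom k)"
  using monom_ops by (rule admI)

lemma Gamma_ops: "Gamma_op \<in> ops 1"
proof -
  have "of_int (i + 1) * Var (nat (i + 1)) \<in> filt (2 * i + 1)" if "i \<ge> 0" for i
  proof -
    have "int (var_weight (nat (i + 1))) = 2 * i + 1"
      using that by (auto simp: var_weight_def)
    then show ?thesis
      by (metis filt_Var filt_mult_left)
  qed
  then show ?thesis
    by (auto simp: ops_def Gamma_op_def simp del: of_int_add)
qed

subsection \<open>Monomials, powers and the inverse of a dressing operator\<close>

context psdo_algebra
begin

lemma mult_monom_right: "A \<odot> psdo_monom k = (\<lambda>n. A (n - k))"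
proof
  fix n
  have "mult_term A (psdo_monom k) n p = 0" if "p \<noteq> (n - k, 0)" for p
    using that by (cases p) (auto simp: mult_term_def psdo_monom_def pow_const)
  then have "(A \<odot> psdo_monom k) n = mult_term A (psdo_monom k) n (n - k, 0)"
    unfolding mult_eq by (rule formal_sum_single)
  then show "(A \<odot> psdo_monom k) n = A (n - k)"
    by (simp add: mult_term_def psdo_monom_def)
qed

lemma mult_monom_monom: "psdo_monom a \<odot> psdo_monom b = psdo_monom (a + b)"
  unfolding mult_monom_right by (rule ext) (auto simp: psdo_monom_def)

lemma mult_1_right [simp]: "A \<odot> psdo_monom 0 = A"
  by (simp add: mult_monom_right)

lemma mult_1_left [simp]: "psdo_monom 0 \<odot> A = A"
proof
  fix n
  have "mult_term (psdo_monom 0) A n p = 0" if "p \<noteq> (0, 0)" for p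
    using that by (cases p) (auto simp: mult_term_def psdo_monom_def gbinomial_0_left)
  then have "(psdo_monom 0 \<odot> A) n = mult_term (psdo_monom 0) A n (0, 0)"
    unfolding mult_eq by (rule formal_sum_single)
  then show "(psdo_monom 0 \<odot> A) n = A n"
    by (simp add: mult_term_def psdo_monom_def)
qed

text \<open>Tailored to \<open>Gamma_op\<close>, whose coefficients have vanishing second
  x-derivative: only r = 0 and r = 1 survive.\<close>

lemma mult_monom_left:
  assumes "\<And>j. d (d (B j)) = 0"
  shows "(psdo_monom k \<odot> B) n = B (n - k) + of_int k * d (B (n - k + 1))"
proof -
  have "(d ^^ r) (B j) = 0" if r: "r \<noteq> 0" "r \<noteq> 1" for r j
  proof -
    have "r = (r - 2) + 2"
      using r by simp
    then have "(d ^^ r) (B j) = (d ^^ (r - 2)) ((d ^^ 2) (B j))"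
      by (metis funpow_add o_apply)
    also have "(d ^^ 2) (B j) = 0"
      using assms by (simp add: numeral_2_eq_2)
    finally show ?thesis
      by simp
  qed
  then have "mult_term (psdo_monom k) B n p = 0" if "p \<notin> {(k, 0), (k, 1)}" for p
    using that by (cases p) (auto simp: mult_term_def psdo_monom_def)
  then have "(psdo_monom k \<odot> B) n = sum (mult_term (psdo_monom k) B n) {(k, 0), (k, 1)}"
    unfolding mult_eq by (intro formal_sum_finite) auto
  then show ?thesis
    by (simp add: mult_term_def psdo_monom_def scaleR_conv_of_real)
qed

lemma mult_order:
  assumes "\<And>n. n > p \<Longrightarrow> A n = 0" "\<And>n. n > q \<Longrightarrow> B n = 0" "n > p + q"
  shows "(A \<odot> B) n = 0"
proof -
  have "mult_term A B n (i, r) = 0" for i r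
  proof (cases "i > p")
    case False
    then have "n - i + int r > q"
      using assms(3) by simp
    then show ?thesis
      using assms(2) by (simp add: mult_term_def)
  qed (simp add: mult_term_def assms(1))
  then have "mult_term A B n = (\<lambda>x. 0)"
    by auto
  then show ?thesis
    by (simp add: mult_eq)
qed

text \<open>Nonnegative orders i and n - i + r together with n < 0 force r > i \<ge> 0, and then the
  binomial coefficient vanishes.\<close>

lemma mult_plus:
  assumes "\<And>n. n < 0 \<Longrightarrow> A n = 0" "\<And>n. n < 0 \<Longrightarrow> B n = 0" "n < 0"
  shows "(A \<odot> B) n = 0"
proof -
  have "mult_term A B n (i, r) = 0" for i r
  proof (cases "i < 0 \<or> n - i + int r < 0")
    case True
    then show ?thesis
      using assms by (auto simp: mult_term_def)
  next
    case False
    define m where "m = nat i"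
    have m: "real_of_int i = real m" "m < r"
      using False assms(3) by (auto simp: m_def)
    then show ?thesis
      by (simp add: mult_term_def binomial_gbinomial[symmetric] binomial_eq_0)
  qed
  then have "mult_term A B n = (\<lambda>x. 0)"
    by auto
  then show ?thesis
    by (simp add: mult_eq)
qed

lemma adm_pow [simp]: "adm A \<Longrightarrow> adm (psdo_pow d A n)"
  by (induction n) auto

lemma pow_mult_ops: "A \<in> ops c \<Longrightarrow> psdo_pow d A n \<in> ops (int n * c)"
proof (induction n)
  case 0
  show ?case
    using monom_ops[of 0] by simp
next
  case (Suc n)
  then show ?case
    using mult_ops[of A c "psdo_pow d A n" "int n * c"] by (simp add: algebra_simps)
qed

lemma psdo_pow_commute: "adm A \<Longrightarrow> psdo_pow d A n \<odot> A = A \<odot> psdo_pow d A n"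
  by (induction n) (auto simp: mult_assoc)

text \<open>Outside a finite set of \<open>k\<close> all terms are small, uniformly in
  \<open>p\<close>; each remaining \<open>k\<close> gives a summable family by itself.\<close>

lemma fsummable_mult_opsum:
  fixes F :: "'i \<Rightarrow> 'b psdo"
  assumes "adm A" "opsummable F"
  shows "fsummable (\<lambda>(p, k). mult_term A (F k) n p)" "fsummable (\<lambda>(p, k). mult_term (F k) A n p)"
proof -
  obtain a where a: "A \<in> ops a"
    using assms(1) by (auto simp: adm_def)
  have *: "fsummable (\<lambda>(p, k). h p k)"
    if "\<And>k. fsummable (\<lambda>p. h p k)" and "\<And>p k c. F k \<in> ops c \<Longrightarrow> h p k \<in> filt (2 * n + (a + c))"
    for h :: "int \<times> nat \<Rightarrow> 'i \<Rightarrow> 'b tseries"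
    unfolding fsummable_def
  proof
    fix w
    let ?K = "{k. F k \<notin> ops (w - 2 * n - a)}"
    have "{x. (case x of (p, k) \<Rightarrow> h p k) \<notin> filt w} \<subseteq> (\<Union>k\<in>?K. {p. h p k \<notin> filt w} \<times> {k})"
      using that(2)[of _ "w - 2 * n - a"] by auto
    moreover have "finite (\<Union>k\<in>?K. {p. h p k \<notin> filt w} \<times> {k})"
      using assms(2) fsummableD[OF that(1)] by (auto simp: opsummable_def)
    ultimately show "finite {x. (case x of (p, k) \<Rightarrow> h p k) \<notin> filt w}"
      by (rule finite_subset)
  qed
  show "fsummable (\<lambda>(p, k). mult_term A (F k) n p)"
    using assms a by (intro *) (auto intro: adm_fsummable opsummable_adm mult_term_filt)
  show "fsummable (\<lambda>(p, k). mult_term (F k) A n p)"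
    using assms mult_term_filt[OF _ a] by (intro *) (auto intro: adm_fsummable opsummable_adm simp: add.commute[of a])
qed

lemma mult_opsum_right:
  assumes "adm A" "opsummable F"
  shows "A \<odot> opsum F = opsum (\<lambda>k. A \<odot> F k)"
proof
  fix n
  have "mult_term A (opsum F) n = (\<lambda>p. formal_sum (\<lambda>k. mult_term A (F k) n p))"
  proof (rule ext, clarify)
    fix i r
    let ?f = "\<lambda>k. F k (n - i + int r)"
    have 1: "fsummable ?f"
      by (rule opsummable_fsummable[OF assms(2)])
    have 2: "fsummable (\<lambda>k. (d ^^ r) (?f k))"
      by (rule fsummable_additive[where e = "int r", OF _ 1]) (rule pow_filt)
    have 3: "fsummable (\<lambda>k. A i * (d ^^ r) (?f k))"
      by (rule fsummable_additive[where e = 0, OF _ 2]) (auto intro: filt_mult_left)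
    show "mult_term A (opsum F) n (i, r) = formal_sum (\<lambda>k. mult_term A (F k) n (i, r))"
      unfolding mult_term_def opsum_def prod.case
      by (simp only: pow_formal_sum[OF 1] formal_sum_mult_left[OF 2] formal_sum_scaleR[OF 3])
  qed
  then show "(A \<odot> opsum F) n = opsum (\<lambda>k. A \<odot> F k) n"
    by (simp add: mult_eq opsum_def formal_sum_swap[OF fsummable_mult_opsum(1)[OF assms]])
qed

lemma mult_opsum_left:
  assumes "adm A" "opsummable F"
  shows "opsum F \<odot> A = opsum (\<lambda>k. F k \<odot> A)"
proof
  fix n
  have "mult_term (opsum F) A n = (\<lambda>p. formal_sum (\<lambda>k. mult_term (F k) A n p))"
  proof (rule ext, clarify)
    fix i r
    have 1: "fsummable (\<lambda>k. F k i)"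
      by (rule opsummable_fsummable[OF assms(2)])
    have 2: "fsummable (\<lambda>k. F k i * (d ^^ r) (A (n - i + int r)))"
      by (rule fsummable_additive[where e = 0, OF _ 1]) (auto intro: filt_mult_right)
    show "mult_term (opsum F) A n (i, r) = formal_sum (\<lambda>k. mult_term (F k) A n (i, r))"
      unfolding mult_term_def opsum_def prod.case
      by (simp only: formal_sum_mult_right[OF 1] formal_sum_scaleR[OF 2])
  qed
  then show "(opsum F \<odot> A) n = opsum (\<lambda>k. F k \<odot> A) n"
    by (simp add: mult_eq opsum_def formal_sum_swap[OF fsummable_mult_opsum(2)[OF assms]])
qed

lemma opsummable_mult:
  assumes "adm A" "opsummable F"
  shows "opsummable (\<lambda>k. A \<odot> F k)" "opsummable (\<lambda>k. F k \<odot> A)"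
proof -
  obtain a where a: "A \<in> ops a"
    using assms(1) by (auto simp: adm_def)
  obtain c where c: "\<And>k. F k \<in> ops c"
    using assms(2) by (auto simp: opsummable_def)
  have fin: "finite {k. F k \<notin> ops c'}" for c'
    using assms(2) by (auto simp: opsummable_def)
  have "{k. A \<odot> F k \<notin> ops c'} \<subseteq> {k. F k \<notin> ops (c' - a)}"
    and "{k. F k \<odot> A \<notin> ops c'} \<subseteq> {k. F k \<notin> ops (c' - a)}" for c'
    using mult_ops[OF a, of _ "c' - a"] mult_ops[OF _ a, of _ "c' - a"] by auto
  then show "opsummable (\<lambda>k. A \<odot> F k)" "opsummable (\<lambda>k. F k \<odot> A)"
    using mult_ops[OF a c] mult_ops[OF c a] finite_subset[OF _ fin]
    unfolding opsummable_def by blast+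
qed

lemma smul_mult_left: "adm A \<Longrightarrow> adm B \<Longrightarrow> smul a A \<odot> B = smul a (A \<odot> B)"
proof
  fix n assume "adm A" "adm B"
  moreover have "mult_term (smul a A) B n = (\<lambda>p. a * mult_term A B n p)"
    by (auto simp: mult_term_def smul_def mult.assoc)
  ultimately show "(smul a A \<odot> B) n = smul a (A \<odot> B) n"
    by (simp add: mult_eq smul_def formal_sum_mult_left adm_fsummable)
qed

lemma smul_mult_right: "d a = 0 \<Longrightarrow> adm A \<Longrightarrow> adm B \<Longrightarrow> A \<odot> smul a B = smul a (A \<odot> B)"
proof
  fix n assume "d a = 0" "adm A" "adm B"
  moreover from this have "mult_term A (smul a B) n = (\<lambda>p. a * mult_term A B n p)"
    by (auto simp: mult_term_def smul_def pow_const_mult mult.left_commute)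
  ultimately show "(A \<odot> smul a B) n = smul a (A \<odot> B) n"
    by (simp add: mult_eq smul_def formal_sum_mult_left adm_fsummable)
qed

lemma dressing_inverse_exists:
  assumes "dressing_op S"
  shows "\<exists>T. (\<forall>n>0. T n = 0) \<and> S \<odot> T = psdo_monom 0 \<and> T \<odot> S = psdo_monom 0"
proof -
  define N where "N = psdo_monom 0 - S"
  have N0: "N n = 0" if "n > -1" for n
    using assms that by (cases "n = 0") (auto simp: N_def dressing_op_def psdo_monom_def)
  \<comment> \<open>\<open>N\<close> has order at most -1, where 2i + 2 \<le> 0 makes the bound
    vacuous.\<close>
  have N_ops: "N \<in> ops 2"
    unfolding ops_def
  proof clarify
    fix i show "N i \<in> filt (2 * i + 2)"
      by (cases "i > -1") (auto simp: N0 filt_nonpos)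
  qed
  then have [simp]: "adm N" by (rule admI)
  have S: "S = psdo_monom 0 - N"
    by (simp add: N_def)
  have pow_order: "psdo_pow d N k n = 0" if "n > 0" for n k
  proof -
    have "\<forall>n>0. psdo_pow d N k n = 0"
    proof (induction k)
      case (Suc k)
      then show ?case
        using mult_order[of 0 N 0 "psdo_pow d N k"] N0 by simp
    qed (simp add: psdo_monom_def)
    then show ?thesis using that by blast
  qed
  \<comment> \<open>The Neumann series converges because \<open>N\<^sup>k \<in> ops (2k)\<close>.\<close>
  define T where "T = opsum (psdo_pow d N)"
  have summ: "opsummable (psdo_pow d N)"
  proof (rule opsummableI)
    show "psdo_pow d N k \<in> ops (int k * 2)" for k
      using N_ops by (rule pow_mult_ops)
    show "finite {k. int k * 2 < c}" for c
      by (rule finite_subset[of _ "{..nat c}"]) auto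
  qed (rule of_nat_0_le_iff[THEN mult_nonneg_nonneg], simp)
  have [simp]: "adm T"
    unfolding T_def by (rule opsum_adm[OF summ])
  \<comment> \<open>Splitting off the term k = 0 gives T = 1 + N T = 1 + T N.\<close>
  have "T = psdo_monom 0 + opsum (\<lambda>k. psdo_pow d N (Suc k))"
    unfolding T_def opsum_def
    by (rule ext) (simp add: formal_sum_Suc[OF opsummable_fsummable[OF summ]])
  moreover have "N \<odot> T = opsum (\<lambda>k. psdo_pow d N (Suc k))"
    "T \<odot> N = opsum (\<lambda>k. psdo_pow d N (Suc k))"
    unfolding T_def by (simp_all add: mult_opsum_left mult_opsum_right summ psdo_pow_commute)
  ultimately have "T - N \<odot> T = psdo_monom 0" "T - T \<odot> N = psdo_monom 0"
    by (metis add_diff_cancel_right')+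
  then have "S \<odot> T = psdo_monom 0" "T \<odot> S = psdo_monom 0"
    by (simp_all add: S mult_diff_left mult_diff_right)
  moreover have "T n = 0" if "n > 0" for n
    using pow_order[OF that] by (simp add: T_def opsum_def)
  ultimately show ?thesis by blast
qed

text \<open>Justifies the definite description: two inverses satisfy T = T S T' = T'. The condition
  on the order makes both admissible, as associativity requires.\<close>

lemma psdo_inv_props:
  assumes "dressing_op S"
  shows "\<And>n. n > 0 \<Longrightarrow> psdo_inv d S n = 0"
    and "S \<odot> psdo_inv d S = psdo_monom 0" and "psdo_inv d S \<odot> S = psdo_monom 0"
proof -
  have adm_S: "adm S"
    by (rule admI[OF ops_nonpos_order]) (use assms in \<open>simp add: dressing_op_def\<close>)
  have "T = T'" if "(\<forall>n>0. T n = 0) \<and> S \<odot> T = psdo_monom 0 \<and> T \<odot> S = psdo_monom 0"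
    "(\<forall>n>0. T' n = 0) \<and> S \<odot> T' = psdo_monom 0 \<and> T' \<odot> S = psdo_monom 0" for T T'
  proof -
    have "adm T" "adm T'"
      using that by (auto intro: admI[OF ops_nonpos_order])
    then have "T \<odot> S \<odot> T' = T \<odot> (S \<odot> T')"
      using adm_S by (intro mult_assoc)
    then show ?thesis
      using that by simp
  qed
  then have "\<exists>!T. (\<forall>n>0. T n = 0) \<and> S \<odot> T = psdo_monom 0 \<and> T \<odot> S = psdo_monom 0"
    using dressing_inverse_exists[OF assms] by blast
  from theI'[OF this]
  show "\<And>n. n > 0 \<Longrightarrow> psdo_inv d S n = 0" "S \<odot> psdo_inv d S = psdo_monom 0"
    "psdo_inv d S \<odot> S = psdo_monom 0"
    unfolding psdo_inv_def by blast+
qed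

section \<open>Commutators and the splitting by order\<close>

abbreviation comm where
  "comm A B \<equiv> A \<odot> B - B \<odot> A"

text \<open>The mixed commutators of \<open>Em\<close> and \<open>Xp\<close> cancel. What remains is
  the commutator of \<open>Em\<close> and \<open>Xm\<close>, of negative order, and that of
  \<open>Xp\<close> and \<open>Ep\<close>, a differential operator without negative part.\<close>

lemma minus_part_comm:
  assumes "adm X" "adm E"
  shows "psdo_minus_part (comm (psdo_minus_part E) X) + psdo_minus_part (comm (psdo_plus_part X) E) =
    comm (psdo_minus_part E) (psdo_minus_part X)"
proof -
  define Xp Xm Ep Em where "Xp = psdo_plus_part X" and "Xm = psdo_minus_part X"
    and "Ep = psdo_plus_part E" and "Em = psdo_minus_part E"
  have X: "X = Xp + Xm" and E: "E = Ep + Em"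
    unfolding Xp_def Xm_def Ep_def Em_def by (rule plus_minus_part)+
  have [simp]: "adm Xp" "adm Xm" "adm Ep" "adm Em"
    using assms by (simp_all add: Xp_def Xm_def Ep_def Em_def)
  have neg: "(Em \<odot> Xm) n = 0" "(Xm \<odot> Em) n = 0" if "n \<ge> 0" for n
    using that by (auto intro!: mult_order[of "-1" _ "-1"]
        simp: Xm_def Em_def psdo_minus_part_def psdo_plus_part_def)
  have pos: "(Ep \<odot> Xp) n = 0" "(Xp \<odot> Ep) n = 0" if "n < 0" for n
    using that by (auto intro!: mult_plus simp: Xp_def Ep_def psdo_plus_part_def)
  have "psdo_minus_part (comm Em Xm) = comm Em Xm"
    by (rule minus_part_of_minus) (simp add: neg)
  moreover have "psdo_minus_part (comm Xp Ep) = 0"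
    by (rule minus_part_of_plus) (simp add: pos)
  moreover have "comm Em X = comm Em Xp + comm Em Xm" "comm Xp E = comm Xp Ep - comm Em Xp"
    unfolding X E by (simp_all add: mult_add_left mult_add_right)
  ultimately have "psdo_minus_part (comm Em X) + psdo_minus_part (comm Xp E) = comm Em Xm"
    by (simp add: minus_part_add minus_part_diff)
  then show ?thesis
    unfolding Xp_def Xm_def Ep_def Em_def .
qed

end

subsection \<open>Derivations of the coefficients acting on operators\<close>

text \<open>Covers both the time derivations and the additional flow.\<close>

locale psdo_derivation = psdo_algebra d + D: filtered_derivation D e
  for d D :: "'b::{comm_ring_1,real_algebra_1} tseries \<Rightarrow> 'b tseries" and e +
  assumes commute: "D (d f) = d (D f)"
begin

lemma pow_commute: "D ((d ^^ r) f) = (d ^^ r) (D f)"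
  by (induction r) (auto simp: commute)

lemma adm_D [simp]: "adm A \<Longrightarrow> adm (D \<circ> A)"
proof -
  have "D \<circ> A \<in> ops (c - e)" if "A \<in> ops c" for c
    using that D.filt[OF opsD[OF that]] by (simp add: ops_def algebra_simps)
  then show "adm A \<Longrightarrow> adm (D \<circ> A)"
    unfolding adm_def by blast
qed

lemma D_mult:
  assumes "adm A" "adm B"
  shows "D \<circ> (A \<odot> B) = (D \<circ> A) \<odot> B + A \<odot> (D \<circ> B)"
proof
  fix n
  have "D (mult_term A B n p) = mult_term (D \<circ> A) B n p + mult_term A (D \<circ> B) n p" for p
    by (cases p) (simp add: mult_term_def D.scaleR_Rats[OF gbinomial_of_int_Rats] D.leibniz
        pow_commute scaleR_add_right)
  then show "(D \<circ> (A \<odot> B)) n = ((D \<circ> A) \<odot> B + A \<odot> (D \<circ> B)) n"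
    using assms by (simp add: mult_eq D.formal_sum adm_fsummable formal_sum_add)
qed

lemma D_monom [simp]: "D \<circ> psdo_monom k = 0"
  by (rule ext) (simp add: psdo_monom_def)

lemma D_minus_part: "D \<circ> psdo_minus_part A = psdo_minus_part (D \<circ> A)"
  by (rule ext) (simp add: psdo_minus_part_def psdo_plus_part_def D.diff)

lemma D_uminus: "D \<circ> (- A) = - (D \<circ> A)"
  by (rule ext) (simp add: D.uminus)

text \<open>The relation says that \<open>D\<close> minus the commutator with \<open>Y\<close>
  annihilates an operator. This difference is a derivation of the product, so its kernel is closed
  under products, hence under powers; the lemmas below add convergent sums and multiples by
  constants.\<close>

lemma D_comm_mult:
  assumes "adm A" "adm B" "adm Y" "D \<circ> A = comm Y A" "D \<circ> B = comm Y B"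
  shows "D \<circ> (A \<odot> B) = comm Y (A \<odot> B)"
  using assms by (simp add: D_mult mult_diff_left mult_diff_right mult_assoc)

lemma D_comm_pow:
  assumes "adm A" "adm Y" "D \<circ> A = comm Y A"
  shows "D \<circ> psdo_pow d A n = comm Y (psdo_pow d A n)"
proof (induction n)
  case (Suc n)
  show ?case
    unfolding psdo_pow.simps by (intro D_comm_mult assms Suc.IH adm_pow)
qed simp

lemma D_opsum: "opsummable F \<Longrightarrow> D \<circ> opsum F = opsum (\<lambda>k. D \<circ> F k)"
  by (rule ext) (simp add: opsum_def D.formal_sum opsummable_fsummable)

lemma D_comm_opsum:
  assumes "opsummable F" "adm Y" "\<And>k. D \<circ> F k = comm Y (F k)"
  shows "D \<circ> opsum F = comm Y (opsum F)"
  using assms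
  by (simp add: D_opsum mult_opsum_left mult_opsum_right opsum_diff opsummable_mult)

lemma D_comm_smul:
  assumes "adm A" "adm Y" "D \<circ> A = comm Y A" "d a = 0" "D a = 0"
  shows "D \<circ> smul a A = comm Y (smul a A)"
proof -
  have "D \<circ> smul a A = smul a (D \<circ> A)"
    using assms(5) by (auto simp: smul_def D.leibniz)
  then show ?thesis
    using assms by (simp add: smul_mult_left smul_mult_right smul_diff)
qed

end

subsection \<open>Flows on the dressing operator\<close>

locale dressed_algebra = psdo_algebra d
  for d :: "'b::{comm_ring_1,real_algebra_1} tseries \<Rightarrow> 'b tseries" +
  fixes S :: "'b psdo"
  assumes dressing: "dressing_op S"
begin

abbreviation T where "T \<equiv> psdo_inv d S"

abbreviation conj where "conj P \<equiv> S \<odot> P \<odot> T"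

lemmas inv_simps [simp] = psdo_inv_props(2,3)[OF dressing]

lemma S_ops: "S \<in> ops 0"
  by (rule ops_nonpos_order) (use dressing in \<open>simp add: dressing_op_def\<close>)

lemma T_ops: "T \<in> ops 0"
  by (rule ops_nonpos_order) (rule psdo_inv_props(1)[OF dressing])

lemma adm_S [simp]: "adm S"
  using S_ops by (rule admI)

lemma adm_T [simp]: "adm T"
  using T_ops by (rule admI)

lemma adm_Gamma [simp]: "adm Gamma_op"
  using Gamma_ops by (rule admI)

lemma T_S_cancel: "adm A \<Longrightarrow> T \<odot> (S \<odot> A) = A"
  using mult_assoc[of T S A] by simp

lemma conj_mult: "adm P \<Longrightarrow> adm Q \<Longrightarrow> conj P \<odot> conj Q = conj (P \<odot> Q)"
  by (simp add: mult_assoc T_S_cancel)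

lemma conj_diff: "adm P \<Longrightarrow> adm Q \<Longrightarrow> conj (P - Q) = conj P - conj Q"
  by (simp add: mult_diff_left mult_diff_right)

abbreviation L where "L \<equiv> Lax_op d S"

abbreviation M where "M \<equiv> Orlov_Shulman_op d S"

lemma adm_L [simp]: "adm L" and adm_M [simp]: "adm M"
  by (simp_all add: Lax_op_def Orlov_Shulman_op_def)

lemma L_ops: "L \<in> ops (- 2)"
  using mult_ops[OF mult_ops[OF S_ops monom_ops[of 1]] T_ops] by (simp add: Lax_op_def)

lemma M_ops: "M \<in> ops 1"
  using mult_ops[OF mult_ops[OF S_ops Gamma_ops] T_ops] by (simp add: Orlov_Shulman_op_def)

text \<open>Conjugation by \<open>S\<close> is multiplicative, so the power falls on
  \<partial>.\<close>

lemma L_pow: "psdo_pow d L n = conj (psdo_monom (int n))"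
proof (induction n)
  case (Suc n)
  then show ?case
    by (simp add: Lax_op_def conj_mult mult_monom_monom)
qed simp

section \<open>The exponential series as a convergent sum of operators\<close>

definition exp_coeff :: "nat \<Rightarrow> nat \<Rightarrow> nat \<Rightarrow> nat \<Rightarrow> 'b tseries" where
  "exp_coeff l k p s = (1 / (fact p * fact s)) *\<^sub>R (of_nat l ^ p * (of_nat k * log_q) ^ s)"

definition exp_term :: "nat \<Rightarrow> nat \<Rightarrow> nat \<times> nat \<Rightarrow> 'b psdo" where
  "exp_term l k = (\<lambda>(p, s). smul (exp_coeff l k p s) (psdo_pow d M p \<odot> psdo_pow d L s))"

lemma exp_op_eq: "exp_op d S l k = opsum (exp_term l k)"
  unfolding exp_op_def opsum_def
  by (rule ext, rule arg_cong[of _ _ formal_sum])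
    (auto simp: exp_term_def exp_coeff_def smul_def mult.assoc)

lemma exp_term_ops: "exp_term l k (p, s) \<in> ops (int p + int s)"
proof -
  have "(of_nat k * log_q) ^ s \<in> filt (int s * 3)"
    using filt_Var[of 0] by (intro filt_power filt_mult_left) (simp add: var_weight_def)
  then have "exp_coeff l k p s \<in> filt (int s * 3)"
    unfolding exp_coeff_def by (intro filt_scaleR filt_mult_left)
  moreover have "psdo_pow d M p \<odot> psdo_pow d L s \<in> ops (int p * 1 + int s * (- 2))"
    by (intro mult_ops pow_mult_ops M_ops L_ops)
  ultimately show ?thesis
    using smul_ops[of "exp_coeff l k p s" "int s * 3" "psdo_pow d M p \<odot> psdo_pow d L s"
        "int p * 1 + int s * (- 2)"]
    by (simp add: exp_term_def add.commute)
qed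

lemma exp_term_opsummable: "opsummable (exp_term l k)"
proof (rule opsummableI)
  show "exp_term l k x \<in> ops (int (fst x) + int (snd x))" for x
    using exp_term_ops by (cases x) auto
  show "0 \<le> int (fst x) + int (snd x)" for x
    by simp
  show "finite {x. int (fst x) + int (snd x) < c}" for c
    by (rule finite_subset[of _ "{..nat c} \<times> {..nat c}"]) auto
qed

lemma adm_exp [simp]: "adm (exp_op d S l k)"
  unfolding exp_op_eq by (rule opsum_adm[OF exp_term_opsummable])

end

locale dressed_derivation = dressed_algebra d S + psdo_derivation d D e
  for d D :: "'b::{comm_ring_1,real_algebra_1} tseries \<Rightarrow> 'b tseries" and S e
begin

text \<open>The series is built from \<open>L\<close> and \<open>M\<close> by products, convergent
  sums and multiples by rational polynomials in \<open>log_q\<close>, which both derivations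
  annihilate.\<close>

lemma D_exp:
  assumes "adm Y" "D \<circ> L = comm Y L" "D \<circ> M = comm Y M" "d log_q = 0" "D log_q = 0"
  shows "D \<circ> exp_op d S l k = comm Y (exp_op d S l k)"
  unfolding exp_op_eq
proof (rule D_comm_opsum[OF exp_term_opsummable assms(1)])
  fix x :: "nat \<times> nat"
  obtain p s where x: "x = (p, s)" by force
  have "(1 / (fact p * fact s) :: real) \<in> \<rat>"
    by (metis Rats_1 Rats_divide Rats_mult Rats_of_nat of_nat_fact)
  then have "d (exp_coeff l k p s) = 0" "D (exp_coeff l k p s) = 0"
    using assms(4,5) unfolding exp_coeff_def
    by (simp_all add: scaleR_Rats D.scaleR_Rats leibniz D.leibniz power_const D.power_const)
  then show "D \<circ> exp_term l k x = comm Y (exp_term l k x)"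
    unfolding x exp_term_def prod.case
    by (intro D_comm_smul D_comm_mult D_comm_pow assms adm_pow adm_mult adm_L adm_M)
qed

end

text \<open>Common form of the two flows: \<open>Y\<close> is the negative part of the n-th power of
  \<open>L\<close> for \<open>dt n\<close>, and of \<open>exp_op\<close> for the additional
  flow.\<close>

locale dressing_flow = dressed_derivation +
  fixes Y :: "'a psdo"
  assumes adm_Y [simp]: "adm Y" and D_S: "D \<circ> S = - (Y \<odot> S)"
begin

text \<open>Differentiate \<open>S \<odot> T = psdo_monom 0\<close>.\<close>

lemma D_T: "D \<circ> T = T \<odot> Y"
proof -
  have "(D \<circ> S) \<odot> T + S \<odot> (D \<circ> T) = 0"
    using D_mult[of S T] by simp
  then have "S \<odot> (D \<circ> T) = Y"
    by (simp add: D_S mult_uminus_left mult_assoc)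
  then show ?thesis
    using T_S_cancel[of "D \<circ> T"] by simp
qed

text \<open>Differentiating the outer factors contributes - Y (S P T) from \<open>S\<close> and (S P
  T) Y from \<open>T\<close>.\<close>

lemma D_conj:
  assumes "adm P"
  shows "D \<circ> conj P = conj (D \<circ> P) - comm Y (conj P)"
  using assms
  by (simp add: D_mult D_S D_T mult_add_left mult_add_right mult_diff_left mult_uminus_left mult_assoc)

lemma D_L_pow: "D \<circ> psdo_pow d L n = comm (- Y) (psdo_pow d L n)"
proof -
  have "D \<circ> L = comm (- Y) L"
    using D_conj[of "psdo_monom 1"] by (simp add: Lax_op_def mult_uminus_left mult_uminus_right)
  then show ?thesis
    by (intro D_comm_pow) simp_all
qed

text \<open>Conjugation turns the commutator with \<partial>^n into the one with the n-th power of
  \<open>L\<close>; subtracting the commutator with its negative part leaves the nonnegative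
  part.\<close>

lemma D_conj_plus_part:
  assumes "Y = psdo_minus_part (psdo_pow d L n)" "adm P" "D \<circ> P = comm (psdo_monom (int n)) P"
  shows "D \<circ> conj P = comm (psdo_plus_part (psdo_pow d L n)) (conj P)"
proof -
  let ?X = "psdo_pow d L n"
  have "D \<circ> conj P = comm ?X (conj P) - comm Y (conj P)"
    using assms(2,3) by (simp add: D_conj L_pow conj_diff conj_mult)
  also have "\<dots> = comm (?X - Y) (conj P)"
    using assms(2) by (simp add: mult_diff_left mult_diff_right)
  also have "?X - Y = psdo_plus_part ?X"
    unfolding assms(1) using plus_minus_part[of ?X] by (metis add_diff_cancel_right')
  finally show ?thesis .
qed

end

text \<open>The loss is the weight of t_n, the only variable not killed; it is sent to 1, of weight
  0.\<close>

lemma filtered_derivation_time: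
  fixes dt :: "nat \<Rightarrow> 'b::{comm_ring_1,real_algebra_1} tseries \<Rightarrow> 'b tseries"
  assumes "KP_time_derivations dt" "n \<ge> 1"
  shows "filtered_derivation (dt n) (2 * int n - 1)"
proof (rule filtered_derivationI)
  show "continuous_derivation (dt n)"
    using assms by (simp add: KP_time_derivations_def)
  show "dt n (Var i) \<in> filt (int (var_weight i) - (2 * int n - 1))" for i
  proof (cases "i = n")
    case True
    then show ?thesis
      using assms(2) by (intro filt_nonpos) (simp add: var_weight_def)
  qed (use assms in \<open>simp add: KP_time_derivations_def\<close>)
qed (use assms(2) in simp)

lemma time_derivation_Gamma:
  fixes dt :: "nat \<Rightarrow> 'b::{comm_ring_1,real_algebra_1} tseries \<Rightarrow> 'b tseries"
  assumes "KP_time_derivations dt" "n \<ge> 1"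
  shows "dt n (Gamma_op j) = (if j + 1 = int n then of_nat n else 0)"
proof -
  interpret filtered_derivation "dt n" "2 * int n - 1"
    using assms by (rule filtered_derivation_time)
  have "dt n (Var i) = (if i = n then 1 else 0)" for i
    using assms by (simp add: KP_time_derivations_def)
  then show ?thesis
    using assms(2) by (auto simp: Gamma_op_def leibniz simp del: of_int_add)
qed

theorem theorem3p2:
  fixes dt :: "nat \<Rightarrow> 'b::{comm_ring_1,real_algebra_1} tseries \<Rightarrow> 'b tseries"
    and S :: "'b psdo"
    and D :: "'b tseries \<Rightarrow> 'b tseries"
    and l k n :: nat
  assumes "KP_time_derivations dt"
    and "dressing_op S"
    and "Sato_equations dt S"
    and "additional_flow dt S l k D"
    and "n \<ge> 1"
  shows "\<forall>j. D (dt n (S j)) - dt n (D (S j)) = 0"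
proof -
  define d where "d = dt 1"
  have fd: "filtered_derivation d 1"
    using filtered_derivation_time[OF assms(1), of 1] by (simp add: d_def)
  \<comment> \<open>All variables are killed by \<open>D\<close>, so it loses no weight.\<close>
  have fD: "filtered_derivation D 0"
    using assms(4) by (intro filtered_derivationI) (auto simp: additional_flow_def)
  interpret dressed_algebra d S
    by (intro dressed_algebra.intro psdo_algebra.intro dressed_algebra_axioms.intro fd assms(2))
  define X E where "X = psdo_pow d L n" and "E = exp_op d S l k"
  have [simp]: "adm X" "adm E"
    by (simp_all add: X_def E_def)
  have "dt n (S j) = (- (psdo_mult d (psdo_minus_part X) S)) j" for j
    using assms(3,5) by (simp add: Sato_equations_def X_def d_def)
  then have dS: "dt n \<circ> S = - (psdo_mult d (psdo_minus_part X) S)"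
    by auto
  have "D (S j) = (- (psdo_mult d (psdo_minus_part E) S)) j" for j
    using assms(4) by (simp add: additional_flow_def E_def d_def)
  then have DS: "D \<circ> S = - (psdo_mult d (psdo_minus_part E) S)"
    by auto
  interpret F: dressing_flow d "dt n" S "2 * int n - 1" "psdo_minus_part X"
    using filtered_derivation_time[OF assms(1,5)] dS assms(1,5)
    by (intro dressing_flow.intro dressed_derivation.intro psdo_derivation.intro
        psdo_derivation_axioms.intro dressing_flow_axioms.intro
        dressed_algebra_axioms psdo_algebra_axioms)
      (auto simp: KP_time_derivations_def d_def)
  interpret G: dressing_flow d D S 0 "psdo_minus_part E"
    using fD DS assms(4)
    by (intro dressing_flow.intro dressed_derivation.intro psdo_derivation.intro
        psdo_derivation_axioms.intro dressing_flow_axioms.intro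
        dressed_algebra_axioms psdo_algebra_axioms)
      (auto simp: additional_flow_def d_def)
  have DX: "D \<circ> X = comm (- psdo_minus_part E) X"
    unfolding X_def by (rule G.D_L_pow)
  have "dt n \<circ> psdo_monom 1 = comm (psdo_monom (int n)) (psdo_monom 1)"
    by (simp add: mult_monom_monom add.commute)
  then have dL: "dt n \<circ> L = comm (psdo_plus_part X) L"
    using F.D_conj_plus_part[of n "psdo_monom 1"] by (simp add: X_def flip: Lax_op_def)
  have Gamma1: "d (Gamma_op j) = (if j = 0 then 1 else 0)" for j
    using time_derivation_Gamma[OF assms(1), of 1 j] by (simp add: d_def)
  \<comment> \<open>Among the coefficients of \<open>Gamma_op\<close> only that of \<partial>^0,
    which is t_1 = x, depends on x. So the commutator is n \<partial>^(n-1), which is also the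
    derivative of \<open>Gamma_op\<close> by t_n.\<close>
  have "dt n \<circ> Gamma_op = comm (psdo_monom (int n)) Gamma_op"
  proof
    fix j
    have "d (d (Gamma_op i)) = 0" for i
      unfolding Gamma1 by simp
    then show "(dt n \<circ> Gamma_op) j = (comm (psdo_monom (int n)) Gamma_op) j"
      using time_derivation_Gamma[OF assms(1,5), of j]
      by (auto simp: mult_monom_left mult_monom_right Gamma1)
  qed
  then have dM: "dt n \<circ> M = comm (psdo_plus_part X) M"
    using F.D_conj_plus_part[of n Gamma_op] by (simp add: X_def flip: Orlov_Shulman_op_def)
  have dE: "dt n \<circ> E = comm (psdo_plus_part X) E"
    unfolding E_def
    by (intro F.D_exp dL dM) (use assms(1,5) in \<open>simp_all add: KP_time_derivations_def d_def\<close>)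
  let ?Xm = "psdo_minus_part X" and ?Em = "psdo_minus_part E"
  have "D \<circ> (dt n \<circ> S) = psdo_mult d (psdo_minus_part (comm ?Em X)) S + psdo_mult d ?Xm (psdo_mult d ?Em S)"
  proof -
    have "comm (- ?Em) X = - comm ?Em X"
      by (simp add: mult_uminus_left mult_uminus_right)
    moreover have "psdo_minus_part (- comm ?Em X) = - psdo_minus_part (comm ?Em X)"
      using minus_part_diff[of 0 "comm ?Em X"] minus_part_diff[of 0 0] by simp
    ultimately show ?thesis
      by (simp add: dS DS G.D_uminus G.D_mult G.D_minus_part DX mult_uminus_left mult_uminus_right)
  qed
  moreover have "dt n \<circ> (D \<circ> S) =
      - psdo_mult d (psdo_minus_part (comm (psdo_plus_part X) E)) S + psdo_mult d ?Em (psdo_mult d ?Xm S)"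
    by (simp add: dS DS F.D_uminus F.D_mult F.D_minus_part dE mult_uminus_right)
  \<comment> \<open>The terms in which both flows act on \<open>S\<close> itself combine to the
    commutator of \<open>?Em\<close> and \<open>?Xm\<close>, with a minus sign.\<close>
  ultimately have "(D \<circ> (dt n \<circ> S)) - (dt n \<circ> (D \<circ> S)) =
      psdo_mult d (psdo_minus_part (comm ?Em X) + psdo_minus_part (comm (psdo_plus_part X) E)
        - comm ?Em ?Xm) S"
    by (simp add: mult_add_left mult_diff_left mult_assoc)
  also have "\<dots> = 0"
    by (simp add: minus_part_comm)
  finally show ?thesis
    by (metis comp_apply fun_diff_def zero_fun_apply)
qed

end
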